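(* Let $G$ be a graph on $[n]$ and $K$ a field. The following are equivalent: (i) the symmetric stable set ideal $I_{G^{\pm}}$ is generated by quadratic binomials; (ii) the stable set ideal $I_G$ is generated by quadratic binomials; (iii) for every $\mathbf{a}\in\mathbb{Z}_{\ge0}^n$ and every integer $k\ge\chi(G_{\mathbf{a}})$, all $k$-colorings of $G_{\mathbf{a}}$ are Kempe equivalent.
   Context: A stable set of $G$ is a subset $S\subset[n]$ containing no edge of $G$ (including $\emptyset$ and singletons). For $S\subset[n]$ let $\rho(S)=\sum_{j\in S}\mathbf{e}_j\in\mathbb{R}^n$. The stable set polytope $\mathcal{P}_G$ is the convex hull of $\rho(S)$ over all stable sets $S$; the symmetric stable set polytope is $\mathcal{P}_G^{\pm}=\{\varepsilon\mathbf{x}:\varepsilon\in\{-1,1\}^n,\mathbf{x}\in\mathcal{P}_G\}$ where $\varepsilon\mathbf{x}=(\varepsilon_1x_1,\dots,\varepsilon_nx_n)$. For a lattice polytope $\mathcal{Q}\subset\mathbb{R}^n$ with $B=\mathcal{Q}\cap\mathbb{Z}^n$, the toric ideal $I_{\mathcal{Q}}$ is the kernel of $K[x_{\mathbf{b}}:\mathbf{b}\in B]\to K[t_1^{\pm1},\dots,t_n^{\pm1},s]$, $x_{\mathbf{b}}\mapsto t_1^{b_1}\cdots t_n^{b_n}s$; $I_G:=I_{\mathcal{P}_G}$ and $I_{G^\pm}:=I_{\mathcal{P}_G^\pm}$. A $k$-coloring of a graph $H$ is a map $f:V(H)\to[k]$ with $f(u)\ne f(v)$ for every edge $\{u,v\}$;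 $\chi(H)$ is the least such $k$. Given a $k$-coloring $f$, $1\le i<j\le k$, and a connected component $C$ of the induced subgraph of $H$ on $f^{-1}(i)\cup f^{-1}(j)$, the coloring $g$ obtained by swapping colors $i$ and $j$ on $C$ (and keeping $f$ elsewhere) is obtained by a Kempe switching; two $k$-colorings are Kempe equivalent if one is reached from the other by a finite sequence of Kempe switchings. For $\mathbf{a}=(a_1,\dots,a_n)\in\mathbb{Z}_{\ge0}^n$, $G_{\mathbf{a}}$ is the graph obtained from $G$ by replacing each vertex $i$ by a complete graph $G^{(i)}$ on $a_i$ vertices (deleting $i$ if $a_i=0$) and joining every vertex of $G^{(i)}$ to every vertex of $G^{(j)}$ whenever $\{i,j\}\in E(G)$ (for $\mathbf{a}=\mathbf{0}$ this is the graph with no vertices). *)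

theory Defs
  imports
    "HOL-Analysis.Analysis"
    "HOL-Algebra.Algebraic_Closure_Type"
    "HOL-Library.Poly_Mapping"
begin

no_notation fps_nth (infixl "$" 75)

section \<open>Graphs, colorings and Kempe equivalence\<close>

text \<open>A graph is given by its vertex set \<open>V\<close> and its set \<open>E\<close> of edges, which are two-element
  sets of vertices.\<close>

definition simple_graph :: "'v set \<Rightarrow> 'v set set \<Rightarrow> bool" where
  "simple_graph V E \<longleftrightarrow> (\<forall>e\<in>E. e \<subseteq> V \<and> card e = 2)"

definition stable_set :: "'v set \<Rightarrow> 'v set set \<Rightarrow> 'v set \<Rightarrow> bool" where
  "stable_set V E S \<longleftrightarrow> S \<subseteq> V \<and> (\<forall>e\<in>E. \<not> e \<subseteq> S)"

text \<open>Colorings are extensional functions, so that equality of colorings is equality on \<open>V\<close>.\<close>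

definition colorings :: "'v set \<Rightarrow> 'v set set \<Rightarrow> nat \<Rightarrow> ('v \<Rightarrow> nat) set" where
  "colorings V E k =
    {f \<in> V \<rightarrow>\<^sub>E {1..k}. \<forall>u\<in>V. \<forall>v\<in>V. {u, v} \<in> E \<longrightarrow> f u \<noteq> f v}"

definition chromatic_number :: "'v set \<Rightarrow> 'v set set \<Rightarrow> nat" where
  "chromatic_number V E = (LEAST k. colorings V E k \<noteq> {})"

definition induced_edges :: "'v set set \<Rightarrow> 'v set \<Rightarrow> 'v set set" where
  "induced_edges E W = {e \<in> E. e \<subseteq> W}"

definition graph_components :: "'v set \<Rightarrow> 'v set set \<Rightarrow> 'v set set" where
  "graph_components V E = V // {(u, v). u \<in> V \<and> v \<in> V \<and> {u, v} \<in> E}\<^sup>*"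

definition kempe_switching ::
    "'v set \<Rightarrow> 'v set set \<Rightarrow> nat \<Rightarrow> (('v \<Rightarrow> nat) \<times> ('v \<Rightarrow> nat)) set" where
  "kempe_switching V E k = {(f, g). f \<in> colorings V E k \<and>
    (\<exists>i j C. 1 \<le> i \<and> i < j \<and> j \<le> k \<and>
      (let W = {v \<in> V. f v = i \<or> f v = j} in C \<in> graph_components W (induced_edges E W)) \<and>
      g = (\<lambda>v. if v \<in> C then Transposition.transpose i j (f v) else f v))}"

definition kempe_equivalent ::
    "'v set \<Rightarrow> 'v set set \<Rightarrow> nat \<Rightarrow> ('v \<Rightarrow> nat) \<Rightarrow> ('v \<Rightarrow> nat) \<Rightarrow> bool" where
  "kempe_equivalent V E k f g \<longleftrightarrow> (f, g) \<in> (kempe_switching V E k)\<^sup>*"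

text \<open>The graph \<open>G\<^sub>a\<close>: the vertices of the complete graph replacing \<open>i\<close> are the pairs \<open>(i, p)\<close>
  with \<open>p < a i\<close>.\<close>

definition blowup_verts :: "'v set \<Rightarrow> ('v \<Rightarrow> nat) \<Rightarrow> ('v \<times> nat) set" where
  "blowup_verts V a = (SIGMA i:V. {..<a i})"

definition blowup_edges ::
    "'v set \<Rightarrow> 'v set set \<Rightarrow> ('v \<Rightarrow> nat) \<Rightarrow> ('v \<times> nat) set set" where
  "blowup_edges V E a = {{(i, p), (j, q)} | i p j q.
    (i, p) \<in> blowup_verts V a \<and> (j, q) \<in> blowup_verts V a \<and>
    (i = j \<and> p \<noteq> q \<or> {i, j} \<in> E)}"


section \<open>Stable set polytopes\<close>

definition indicator_vec :: "'n::finite set \<Rightarrow> real ^ 'n" where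
  "indicator_vec S = (\<Sum>j\<in>S. axis j 1)"

definition stable_set_polytope :: "'n::finite set set \<Rightarrow> (real ^ 'n) set" where
  "stable_set_polytope E = convex hull {indicator_vec S | S. stable_set UNIV E S}"

definition sym_stable_set_polytope :: "'n::finite set set \<Rightarrow> (real ^ 'n) set" where
  "sym_stable_set_polytope E =
    {(\<chi> i. \<epsilon> $ i * x $ i) | \<epsilon> x. (\<forall>i. \<epsilon> $ i \<in> {-1, 1}) \<and> x \<in> stable_set_polytope E}"


section \<open>Toric ideals\<close>

text \<open>A polynomial with indeterminates of type \<open>'x\<close> is a finitely supported function from
  monomials \<open>'x \<Rightarrow>\<^sub>0 nat\<close> to coefficients.\<close>

type_synonym ('x, 'k) mpoly = "('x \<Rightarrow>\<^sub>0 nat) \<Rightarrow>\<^sub>0 'k"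

definition mpoly_ring :: "'x set \<Rightarrow> ('x, 'k::field) mpoly ring" where
  "mpoly_ring B = ring_of_type_algebra
    \<lparr>carrier := {p. \<forall>m\<in>Poly_Mapping.keys p. Poly_Mapping.keys m \<subseteq> B}\<rparr>"

definition monomial_degree :: "('x \<Rightarrow>\<^sub>0 nat) \<Rightarrow> nat" where
  "monomial_degree m = (\<Sum>x\<in>Poly_Mapping.keys m. Poly_Mapping.lookup m x)"

definition total_degree :: "('x, 'k::field) mpoly \<Rightarrow> nat" where
  "total_degree p = Max (monomial_degree ` Poly_Mapping.keys p)"

definition is_binomial :: "('x, 'k::field) mpoly \<Rightarrow> bool" where
  "is_binomial p \<longleftrightarrow> (\<exists>u v. u \<noteq> v \<and> p = Poly_Mapping.single u 1 - Poly_Mapping.single v 1)"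

text \<open>The zero ideal is generated by the empty set, hence counts as generated by quadratic
  binomials.\<close>

definition generated_by_quadratic_binomials ::
    "'x set \<Rightarrow> ('x, 'k::field) mpoly set \<Rightarrow> bool" where
  "generated_by_quadratic_binomials B I \<longleftrightarrow>
    (\<exists>F \<subseteq> carrier (mpoly_ring B).
      (\<forall>p\<in>F. is_binomial p \<and> total_degree p = 2) \<and> I = genideal (mpoly_ring B) F)"

definition lattice_points :: "(real ^ 'n) set \<Rightarrow> (int ^ 'n) set" where
  "lattice_points Q = {b. (\<chi> i. real_of_int (b $ i)) \<in> Q}"

text \<open>The ring \<open>K[t\<^sub>1\<^sup>\<plusminus>\<^sup>1, \<dots>, t\<^sub>n\<^sup>\<plusminus>\<^sup>1, s]\<close> is the monoid algebra of
  \<open>\<int>\<^sup>n \<times> \<nat>\<close>; the pair \<open>(b, d)\<close> stands for the monomial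
  \<open>t\<^sub>1\<^bsup>b\<^sub>1\<^esup> \<cdots> t\<^sub>n\<^bsup>b\<^sub>n\<^esup> s\<^sup>d\<close>.\<close>

type_synonym ('n, 'k) laurent = "((int ^ 'n) \<times> nat) \<Rightarrow>\<^sub>0 'k"

definition toric_map :: "(int ^ 'n::finite, 'k::field) mpoly \<Rightarrow> ('n, 'k) laurent" where
  "toric_map p = (\<Sum>m\<in>Poly_Mapping.keys p. Poly_Mapping.single 0 (Poly_Mapping.lookup p m) *
    (\<Prod>b\<in>Poly_Mapping.keys m. Poly_Mapping.single (b, 1) 1 ^ Poly_Mapping.lookup m b))"

definition toric_ideal ::
    "'k::field itself \<Rightarrow> (real ^ 'n::finite) set \<Rightarrow> (int ^ 'n, 'k) mpoly set" where
  "toric_ideal _ Q = a_kernel (mpoly_ring (lattice_points Q))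
    (ring_of_type_algebra :: ('n, 'k) laurent ring) toric_map"

definition stable_set_ideal ::
    "'k::field itself \<Rightarrow> 'n::finite set set \<Rightarrow> (int ^ 'n, 'k) mpoly set" where
  "stable_set_ideal K E = toric_ideal K (stable_set_polytope E)"

definition sym_stable_set_ideal ::
    "'k::field itself \<Rightarrow> 'n::finite set set \<Rightarrow> (int ^ 'n, 'k) mpoly set" where
  "sym_stable_set_ideal K E = toric_ideal K (sym_stable_set_polytope E)"

end

theory Submission
  imports Defs
begin

text \<open>Both toric ideals are spanned by the differences of monomials with the same image, so being
  generated by quadratic binomials means that any two tuples of lattice points with the same sum
  are connected by moves that replace two entries by two entries with the same sum. For one
  direction, the functionals on polynomials that are constant along such moves annihilate an ideal
  containing all quadratic binomials of the toric ideal.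

  A \<open>k\<close>-tuple of stable sets with sum \<open>a\<close> is the tuple of color classes of a \<open>k\<close>-coloring of
  \<open>G\<^sub>a\<close>; a Kempe switching is a move, and conversely a move lifts to a sequence of Kempe switchings
  with two fixed colors.

  For the symmetric polytope one may assume, by changing signs of coordinates, that the sum is
  nonnegative. Deleting at each vertex equally many entries \<open>1\<close> as there are entries \<open>-1\<close>, and all
  entries \<open>-1\<close>, gives a tuple of stable sets with the same sum. It is reached by moves, it is
  unique up to moves of stable sets, and a move of signed tuples induces a move between suitable
  such reductions.\<close>

section \<open>Moves on tuples\<close>

text \<open>Tuples are ordered because their indices become colors, whereas a monomial records only
  multiplicities. Exchanging two entries preserves their sum, so all orderings of a tuple are
  connected by moves and the two views agree. The indicator of the monomials reachable from a given
  tuple is constant along moves; its values 0 and 1 differ over every field, so annihilation can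
  certify reachability.

  In the signed case the obstacle is a move that turns the values 1, -1 at a vertex into 0, 0: a
  reduction that kept this 1 cannot follow it. Since the total at the vertex is nonnegative, enough
  other entries 1 are available, so some reduction avoids the two positions there. All reductions of
  one tuple are connected, hence the reduction may be exchanged before every move.

  In the lifting of a move to colorings, a vertex with copies of both colors keeps its coloring;
  only a vertex with exactly one copy in these colors leaves something to decide, and the target
  tuple decides it.\<close>

definition tuple_moves :: "'b::plus set \<Rightarrow> nat \<Rightarrow> ((nat \<Rightarrow> 'b) \<times> (nat \<Rightarrow> 'b)) set" where
  "tuple_moves B k = {(x, y). x \<in> {1..k} \<rightarrow>\<^sub>E B \<and> y \<in> {1..k} \<rightarrow>\<^sub>E B \<and>
    (\<exists>p\<in>{1..k}. \<exists>q\<in>{1..k}. p \<noteq> q \<and> x p + x q = y p + y q \<and>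
      (\<forall>i. i \<noteq> p \<longrightarrow> i \<noteq> q \<longrightarrow> x i = y i))}"

text \<open>Only tuples of equal length are compared, because the exponent of \<open>s\<close>
  records the length. All three statements of the theorem are reduced to this property.\<close>

definition quad_connected :: "'b::comm_monoid_add set \<Rightarrow> bool" where
  "quad_connected B \<longleftrightarrow> (\<forall>k. \<forall>x \<in> {1..k} \<rightarrow>\<^sub>E B. \<forall>y \<in> {1..k} \<rightarrow>\<^sub>E B.
    sum x {1..k} = sum y {1..k} \<longrightarrow> (x, y) \<in> (tuple_moves B k)\<^sup>*)"

lemma tuple_movesI:
  assumes "x \<in> {1..k} \<rightarrow>\<^sub>E B" "y \<in> {1..k} \<rightarrow>\<^sub>E B" "p \<in> {1..k}" "q \<in> {1..k}" "p \<noteq> q"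
    "x p + x q = y p + y q" "\<And>i. i \<noteq> p \<Longrightarrow> i \<noteq> q \<Longrightarrow> x i = y i"
  shows "(x, y) \<in> tuple_moves B k"
  using assms unfolding tuple_moves_def by blast

lemma tuple_movesE:
  assumes "(x, y) \<in> tuple_moves B k"
  obtains p q where "x \<in> {1..k} \<rightarrow>\<^sub>E B" "y \<in> {1..k} \<rightarrow>\<^sub>E B" "p \<in> {1..k}" "q \<in> {1..k}" "p \<noteq> q"
    "x p + x q = y p + y q" "\<And>i. i \<noteq> p \<Longrightarrow> i \<noteq> q \<Longrightarrow> x i = y i"
  using assms unfolding tuple_moves_def by blast

lemma sum_two_diff:
  fixes x :: "nat \<Rightarrow> 'b::comm_monoid_add"
  assumes "p \<in> {1..k}" "q \<in> {1..k}" "p \<noteq> q"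
  shows "sum x {1..k} = x p + x q + sum x ({1..k} - {p, q})"
proof -
  have "sum x {1..k} = x p + sum x ({1..k} - {p})"
    using assms by (simp add: sum.remove)
  also have "sum x ({1..k} - {p}) = x q + sum x ({1..k} - {p} - {q})"
    using assms by (subst sum.remove[of _ q]) auto
  also have "{1..k} - {p} - {q} = {1..k} - {p, q}"
    by blast
  finally show ?thesis
    by (simp add: add.assoc)
qed

lemma tuple_moves_sym: "sym (tuple_moves B k)"
  by (rule symI) (elim tuple_movesE, rule tuple_movesI, auto)

lemma tuple_moves_rtrancl_sym: "(x, y) \<in> (tuple_moves B k)\<^sup>* \<Longrightarrow> (y, x) \<in> (tuple_moves B k)\<^sup>*"
  by (meson tuple_moves_sym sym_rtrancl symE)

lemma tuple_moves_rtrancl_tuple: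
  "(x, y) \<in> (tuple_moves B k)\<^sup>* \<Longrightarrow> x \<in> {1..k} \<rightarrow>\<^sub>E B \<Longrightarrow> y \<in> {1..k} \<rightarrow>\<^sub>E B"
  by (induction rule: rtrancl_induct) (assumption, erule tuple_movesE, assumption)

lemma tuple_moves_sum:
  fixes x :: "nat \<Rightarrow> 'b::comm_monoid_add"
  assumes "(x, y) \<in> tuple_moves B k"
  shows "sum x {1..k} = sum y {1..k}"
  using assms
proof (rule tuple_movesE)
  fix p q assume pq: "p \<in> {1..k}" "q \<in> {1..k}" "p \<noteq> q" "x p + x q = y p + y q"
    and eq: "\<And>i. i \<noteq> p \<Longrightarrow> i \<noteq> q \<Longrightarrow> x i = y i"
  have "sum x ({1..k} - {p, q}) = sum y ({1..k} - {p, q})"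
    by (rule sum.cong) (auto intro: eq)
  then show ?thesis
    unfolding sum_two_diff[OF pq(1-3)] by (simp only: pq(4))
qed

text \<open>A swap of two entries is a move. Swapping a wrong entry with a misplaced copy of the
  value wanted there lowers the number of disagreements. This is what passes from equality of
  monomials back to tuples.\<close>

lemma same_fibres_connected:
  fixes x y :: "nat \<Rightarrow> 'b::comm_monoid_add"
  assumes "x \<in> {1..k} \<rightarrow>\<^sub>E B" "y \<in> {1..k} \<rightarrow>\<^sub>E B"
    and "\<And>b. card {i\<in>{1..k}. x i = b} = card {i\<in>{1..k}. y i = b}"
  shows "(x, y) \<in> (tuple_moves B k)\<^sup>*"
  using assms
proof (induction "card {i\<in>{1..k}. x i \<noteq> y i}" arbitrary: x rule: less_induct)
  case less
  show ?case
  proof (cases "\<exists>i\<in>{1..k}. x i \<noteq> y i")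
    case False
    then have "x = y"
      using less.prems(1,2) by (intro PiE_ext) auto
    then show ?thesis by simp
  next
    case True
    then obtain i where i: "i \<in> {1..k}" "x i \<noteq> y i" by blast
    \<comment> \<open>Otherwise the fibre of \<open>x\<close> over \<open>y i\<close> would lie in
      that of \<open>y\<close>, properly so because \<open>i\<close> belongs only to the latter,
      against equal cardinalities.\<close>
    have "\<exists>j\<in>{1..k}. x j = y i \<and> y j \<noteq> y i"
    proof (rule ccontr)
      assume "\<not> ?thesis"
      then have "{j\<in>{1..k}. x j = y i} \<subset> {j\<in>{1..k}. y j = y i}"
        using i by auto
      then have "card {j\<in>{1..k}. x j = y i} < card {j\<in>{1..k}. y j = y i}"
        by (intro psubset_card_mono) auto
      then show False using less.prems(3) by simp
    qed
    then obtain j where j: "j \<in> {1..k}" "x j = y i" "y j \<noteq> y i" by blast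
    have ij: "i \<noteq> j" using i j by auto
    define z where "z = x(i := x j, j := x i)"
    have z: "z \<in> {1..k} \<rightarrow>\<^sub>E B"
      using less.prems(1) i j unfolding z_def by (auto simp: PiE_def Pi_def extensional_def)
    have move: "(x, z) \<in> tuple_moves B k"
      using less.prems(1) z i(1) j(1) ij
      by (rule tuple_movesI) (auto simp: z_def ij add.commute)
    have "z = x \<circ> Transposition.transpose i j"
      by (auto simp: z_def fun_eq_iff Transposition.transpose_def)
    then have fibres: "card {l\<in>{1..k}. z l = b} = card {l\<in>{1..k}. x l = b}" for b
      using i(1) j(1)
      by (intro bij_betw_same_card[where f = "Transposition.transpose i j"] bij_betwI[where g = "Transposition.transpose i j"])
        (auto simp: Transposition.transpose_def)
    have "{l\<in>{1..k}. z l \<noteq> y l} \<subset> {l\<in>{1..k}. x l \<noteq> y l}"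
      using i j by (auto simp: z_def split: if_splits)
    then have "card {l\<in>{1..k}. z l \<noteq> y l} < card {l\<in>{1..k}. x l \<noteq> y l}"
      by (intro psubset_card_mono) auto
    then have "(z, y) \<in> (tuple_moves B k)\<^sup>*"
      using less.hyps z less.prems fibres by simp
    with move show ?thesis by (rule converse_rtrancl_into_rtrancl)
  qed
qed

section \<open>Toric ideals and moves\<close>

definition tuple_monom :: "nat \<Rightarrow> (nat \<Rightarrow> 'x) \<Rightarrow> ('x \<Rightarrow>\<^sub>0 nat)" where
  "tuple_monom k x = (\<Sum>i\<in>{1..k}. Poly_Mapping.single (x i) 1)"

text \<open>The exponent in \<open>t\<close> and \<open>s\<close> of the image of a monomial.
  Multiplication on vectors is componentwise and \<open>of_nat\<close> yields a constant vector, so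
  the first component is a sum of scalar multiples.\<close>

definition toric_exp :: "((int ^ 'n) \<Rightarrow>\<^sub>0 nat) \<Rightarrow> (int ^ 'n) \<times> nat" where
  "toric_exp m = (\<Sum>b\<in>Poly_Mapping.keys m.
     (of_nat (Poly_Mapping.lookup m b) * b, Poly_Mapping.lookup m b))"

text \<open>The linear extension of \<open>h\<close> from monomials to polynomials. As
  \<open>h\<close> may be any function on monomials, ideals can be cut out by annihilation
  conditions.\<close>

definition pairing :: "('x, 'k::field) mpoly \<Rightarrow> (('x \<Rightarrow>\<^sub>0 nat) \<Rightarrow> 'k) \<Rightarrow> 'k" where
  "pairing p h = (\<Sum>m\<in>Poly_Mapping.keys p. Poly_Mapping.lookup p m * h m)"

lemma lookup_tuple_monom: "Poly_Mapping.lookup (tuple_monom k x) b = card {i\<in>{1..k}. x i = b}"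
proof -
  have "Poly_Mapping.lookup (tuple_monom k x) b = (\<Sum>i\<in>{1..k}. if x i = b then 1 else 0)"
    by (simp add: tuple_monom_def lookup_sum lookup_single when_def del: One_nat_def)
  also have "\<dots> = card {i\<in>{1..k}. x i = b}"
    unfolding card_eq_sum by (rule sum.inter_filter[symmetric]) simp
  finally show ?thesis .
qed

lemma keys_tuple_monom: "Poly_Mapping.keys (tuple_monom k x) = x ` {1..k}"
  by (auto simp: in_keys_iff lookup_tuple_monom card_gt_0_iff)

lemma keys_add_nat:
  fixes m m' :: "'x \<Rightarrow>\<^sub>0 nat"
  shows "Poly_Mapping.keys (m + m') = Poly_Mapping.keys m \<union> Poly_Mapping.keys m'"
  by (auto simp: in_keys_iff lookup_add)

lemma tuple_monom_two:
  assumes "p \<in> {1..k}" "q \<in> {1..k}" "p \<noteq> q"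
  shows "tuple_monom k x = Poly_Mapping.single (x p) 1 + Poly_Mapping.single (x q) 1
    + (\<Sum>i\<in>{1..k} - {p, q}. Poly_Mapping.single (x i) 1)"
  unfolding tuple_monom_def by (rule sum_two_diff[OF assms])

lemma monomial_degree_add: "monomial_degree (m + m') = monomial_degree m + monomial_degree m'"
  unfolding monomial_degree_def by (rule setsum_keys_plus_distrib) auto

lemma monomial_degree_single: "monomial_degree (Poly_Mapping.single b c) = c"
  by (simp add: monomial_degree_def)

lemma monomial_degree_0: "monomial_degree 0 = 0"
  by (simp add: monomial_degree_def)

lemma ex_tuple_monom:
  assumes "Poly_Mapping.keys m \<subseteq> B"
  shows "\<exists>x \<in> {1..monomial_degree m} \<rightarrow>\<^sub>E B. m = tuple_monom (monomial_degree m) x"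
  using assms
proof (induction "monomial_degree m" arbitrary: m)
  case 0
  then have "m = 0"
    by (auto simp: monomial_degree_def in_keys_iff intro!: poly_mapping_eqI)
  then show ?case by (simp add: tuple_monom_def monomial_degree_0)
next
  case (Suc k)
  then have "Poly_Mapping.keys m \<noteq> {}"
    by (auto simp: monomial_degree_def)
  then obtain b where b: "b \<in> Poly_Mapping.keys m" by blast
  define m' where "m' = m - Poly_Mapping.single b 1"
  have m: "m = m' + Poly_Mapping.single b 1"
    using b by (auto simp: m'_def lookup_add lookup_minus lookup_single when_def in_keys_iff
        intro!: poly_mapping_eqI)
  have deg: "k = monomial_degree m'"
    using Suc.hyps(2) m by (simp add: monomial_degree_add monomial_degree_single)
  have "Poly_Mapping.keys m' \<subseteq> B"
    using Suc.prems m keys_add_nat[of m' "Poly_Mapping.single b 1"] by simp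
  from Suc.hyps(1)[OF deg this, folded deg] obtain x where
    x: "x \<in> {1..k} \<rightarrow>\<^sub>E B" "m' = tuple_monom k x" by blast
  have "x(Suc k := b) \<in> {1..Suc k} \<rightarrow>\<^sub>E B"
    using x(1) b Suc.prems by (auto simp: PiE_def Pi_def extensional_def)
  moreover have "tuple_monom (Suc k) (x(Suc k := b)) = m"
    by (simp add: m x(2) tuple_monom_def)
  ultimately show ?case 
    unfolding Suc.hyps(2)[symmetric] by (intro bexI[of _ "x(Suc k := b)"]) (rule sym)
qed

lemma toric_exp_add: "toric_exp (m + m') = toric_exp m + toric_exp m'"
  unfolding toric_exp_def
  by (rule setsum_keys_plus_distrib) (auto simp: zero_prod_def distrib_right)

lemma toric_exp_0: "toric_exp 0 = 0"
  by (simp add: toric_exp_def)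

lemma toric_exp_sum: "toric_exp (sum f A) = (\<Sum>i\<in>A. toric_exp (f i))"
  by (induction A rule: infinite_finite_induct) (auto simp: toric_exp_add toric_exp_0)

lemma toric_exp_single: "toric_exp (Poly_Mapping.single b 1) = (b, 1)"
  by (simp add: toric_exp_def)

lemma toric_exp_tuple_monom: "toric_exp (tuple_monom k x) = (sum x {1..k}, k)"
proof -
  have "toric_exp (tuple_monom k x) = (\<Sum>i\<in>{1..k}. (x i, 1))"
    by (simp add: tuple_monom_def toric_exp_sum toric_exp_single del: One_nat_def)
  then show ?thesis
    by (simp add: prod_eq_iff fst_sum snd_sum)
qed

lemma toric_exp_degree: "snd (toric_exp m) = monomial_degree m"
  by (simp add: toric_exp_def monomial_degree_def snd_sum)

section \<open>Linear functionals on polynomials and the ideals they annihilate\<close>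

lemma poly_mapping_sum_single:
  "p = (\<Sum>m\<in>Poly_Mapping.keys p. Poly_Mapping.single m (Poly_Mapping.lookup p m))"
  by (rule poly_mapping_eqI)
    (auto simp: lookup_sum lookup_single when_def sum.delta' in_keys_iff)

lemma pairing_add: "pairing (p + q) h = pairing p h + pairing q h"
  unfolding pairing_def by (rule setsum_keys_plus_distrib) (auto simp: distrib_right)

lemma pairing_single: "pairing (Poly_Mapping.single m c) h = c * h m"
  by (simp add: pairing_def)

lemma pairing_0: "pairing 0 h = 0"
  by (simp add: pairing_def)

lemma pairing_uminus: "pairing (- p) h = - pairing p h"
  using pairing_add[of p "- p" h] by (simp add: pairing_0 add_eq_0_iff)

lemma pairing_diff: "pairing (p - q) h = pairing p h - pairing q h"
  using pairing_add[of p "- q" h] by (simp add: pairing_uminus)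

lemma pairing_sum: "pairing (sum f A) h = (\<Sum>i\<in>A. pairing (f i) h)"
  by (induction A rule: infinite_finite_induct) (auto simp: pairing_add pairing_0)

text \<open>Only the first factor is expanded, so that multiplication by a monomial appears as a
  translation of the functional.\<close>

lemma pairing_mult:
  "pairing (p * q) h =
    (\<Sum>m\<in>Poly_Mapping.keys p. Poly_Mapping.lookup p m * pairing q (\<lambda>n. h (m + n)))"
proof -
  have "p * q = (\<Sum>m\<in>Poly_Mapping.keys p. \<Sum>n\<in>Poly_Mapping.keys q.
    Poly_Mapping.single (m + n) (Poly_Mapping.lookup p m * Poly_Mapping.lookup q n))"
    by (subst poly_mapping_sum_single[of p], subst poly_mapping_sum_single[of q])
      (simp add: sum_product mult_single)
  then have "pairing (p * q) h = (\<Sum>m\<in>Poly_Mapping.keys p. \<Sum>n\<in>Poly_Mapping.keys q.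
    Poly_Mapping.lookup p m * Poly_Mapping.lookup q n * h (m + n))"
    by (simp only: pairing_sum pairing_single)
  then show ?thesis
    by (simp add: sum_distrib_left mult.assoc pairing_def)
qed

lemma mpoly_ring_simps [simp]:
  "carrier (mpoly_ring B) = {p. \<forall>m\<in>Poly_Mapping.keys p. Poly_Mapping.keys m \<subseteq> B}"
  "p \<otimes>\<^bsub>mpoly_ring B\<^esub> q = p * q" "p \<oplus>\<^bsub>mpoly_ring B\<^esub> q = p + q"
  "\<zero>\<^bsub>mpoly_ring B\<^esub> = 0" "\<one>\<^bsub>mpoly_ring B\<^esub> = 1"
  by (simp_all add: mpoly_ring_def ring_of_type_algebra_def)

lemma keys_uminus: "Poly_Mapping.keys (- p) = Poly_Mapping.keys (p :: 'a \<Rightarrow>\<^sub>0 'b::ab_group_add)"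
  by (auto simp: in_keys_iff)

lemma cring_mpoly_ring: "cring (mpoly_ring B :: ('x, 'k::field) mpoly ring)"
proof -
  have add: "p + q \<in> carrier (mpoly_ring B)"
    if "p \<in> carrier (mpoly_ring B)" "q \<in> carrier (mpoly_ring B)" for p q :: "('x, 'k) mpoly"
    using that keys_add[of p q] by auto
  have mult: "p * q \<in> carrier (mpoly_ring B)"
    if "p \<in> carrier (mpoly_ring B)" "q \<in> carrier (mpoly_ring B)" for p q :: "('x, 'k) mpoly"
    using that keys_mult[of p q] by (fastforce simp: keys_add_nat)
  have uminus: "- p \<in> carrier (mpoly_ring B)"
    if "p \<in> carrier (mpoly_ring B)" for p :: "('x, 'k) mpoly"
    using that by (simp add: keys_uminus)
  show ?thesis
  proof (rule cringI)
    show "abelian_group (mpoly_ring B :: ('x, 'k) mpoly ring)"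
    proof (rule abelian_groupI)
      show "p \<oplus>\<^bsub>mpoly_ring B\<^esub> q \<in> carrier (mpoly_ring B)"
        if "p \<in> carrier (mpoly_ring B)" "q \<in> carrier (mpoly_ring B)" for p q :: "('x, 'k) mpoly"
        using add[OF that] by simp
      show "\<exists>q\<in>carrier (mpoly_ring B). q \<oplus>\<^bsub>mpoly_ring B\<^esub> p = \<zero>\<^bsub>mpoly_ring B\<^esub>"
        if "p \<in> carrier (mpoly_ring B)" for p :: "('x, 'k) mpoly"
        using uminus[OF that] by (intro bexI[of _ "- p"]) simp_all
    qed (simp_all add: ac_simps)
    show "comm_monoid (mpoly_ring B :: ('x, 'k) mpoly ring)"
    proof (rule comm_monoidI)
      show "p \<otimes>\<^bsub>mpoly_ring B\<^esub> q \<in> carrier (mpoly_ring B)"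
        if "p \<in> carrier (mpoly_ring B)" "q \<in> carrier (mpoly_ring B)" for p q :: "('x, 'k) mpoly"
        using mult[OF that] by simp
    qed (simp_all add: ac_simps)
  qed (simp add: algebra_simps)
qed

text \<open>By \<open>pairing_mult\<close>, pairing a multiple of \<open>p\<close> with
  \<open>h\<close> is a combination of pairings of \<open>p\<close> with translates of
  \<open>h\<close>, and these stay in \<open>H\<close>. It serves both for the toric ideal and for
  the ideal defined by invariance under moves.\<close>

lemma ideal_annihilator:
  assumes shift: "\<And>h w. h \<in> H \<Longrightarrow> Poly_Mapping.keys w \<subseteq> B \<Longrightarrow> (\<lambda>m. h (w + m)) \<in> H"
  shows "ideal {p \<in> carrier (mpoly_ring B). \<forall>h\<in>H. pairing p h = 0}
    (mpoly_ring B :: ('x, 'k::field) mpoly ring)" (is "ideal ?J ?R")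
proof -
  interpret R: cring ?R by (rule cring_mpoly_ring)
  have sub: "?J \<subseteq> carrier ?R" by blast
  \<comment> \<open>The additive inverse of the ring record is identified with the minus of the
    type, for which the pairing is already known.\<close>
  have inv: "inv\<^bsub>add_monoid ?R\<^esub> p = - p" if "p \<in> carrier ?R" for p
    unfolding a_inv_def[symmetric]
    using that by (intro R.minus_equality) (auto simp: keys_uminus)
  have closed: "q * p \<in> ?J" if p: "p \<in> ?J" and q: "q \<in> carrier ?R" for p q
  proof -
    have "q * p \<in> carrier ?R" using R.m_closed[of q p] p q by simp
    moreover have "pairing (q * p) h = 0" if h: "h \<in> H" for h
      unfolding pairing_mult
    proof (rule sum.neutral, rule ballI)
      fix m assume "m \<in> Poly_Mapping.keys q"
      then have "(\<lambda>n. h (m + n)) \<in> H" using shift[OF h] q by simp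
      then show "Poly_Mapping.lookup q m * pairing p (\<lambda>n. h (m + n)) = 0" using p by simp
    qed
    ultimately show ?thesis by blast
  qed
  show ?thesis
  proof (rule idealI)
    show "ring ?R" ..
    show "subgroup ?J (add_monoid ?R)"
    proof
      show "?J \<subseteq> carrier (add_monoid ?R)" by auto
      show "p \<otimes>\<^bsub>add_monoid ?R\<^esub> q \<in> ?J" if "p \<in> ?J" "q \<in> ?J" for p q
        using that R.a_closed[of p q] by (auto simp: pairing_add)
      show "\<one>\<^bsub>add_monoid ?R\<^esub> \<in> ?J" by (simp add: pairing_0)
      show "inv\<^bsub>add_monoid ?R\<^esub> p \<in> ?J" if "p \<in> ?J" for p
        using that by (subst inv) (auto simp: pairing_uminus keys_uminus)
    qed
    show "q \<otimes>\<^bsub>?R\<^esub> p \<in> ?J" if "p \<in> ?J" "q \<in> carrier ?R" for p q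
      unfolding mpoly_ring_simps(2) by (rule closed[OF that])
    show "p \<otimes>\<^bsub>?R\<^esub> q \<in> ?J" if "p \<in> ?J" "q \<in> carrier ?R" for p q
      unfolding mpoly_ring_simps(2) mult.commute[of p q] by (rule closed[OF that])
  qed
qed

section \<open>Toric ideals and the binomials they contain\<close>

definition binom :: "('x \<Rightarrow>\<^sub>0 nat) \<Rightarrow> ('x \<Rightarrow>\<^sub>0 nat) \<Rightarrow> ('x, 'k::field) mpoly" where
  "binom u v = Poly_Mapping.single u 1 - Poly_Mapping.single v 1"

lemma single_power:
  fixes b :: "int ^ 'n::finite"
  shows "Poly_Mapping.single (b, 1 :: nat) (1 :: 'k::field) ^ n = Poly_Mapping.single (of_nat n * b, n) 1"
proof (induction n)
  case 0
  have "(0 * b, 0::nat) = 0" by (simp add: zero_prod_def)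
  then show ?case by simp
next
  case (Suc n)
  then show ?case by (simp add: mult_single distrib_right)
qed

lemma prod_single:
  "(\<Prod>b\<in>A. Poly_Mapping.single (f b) 1) = Poly_Mapping.single (\<Sum>b\<in>A. f b) (1 :: 'k::field)"
  by (induction A rule: infinite_finite_induct) (simp_all add: mult_single)

lemma toric_map_eq:
  "toric_map p = (\<Sum>m\<in>Poly_Mapping.keys p. Poly_Mapping.single (toric_exp m) (Poly_Mapping.lookup p m))"
  unfolding toric_map_def single_power prod_single toric_exp_def[symmetric]
  by (simp add: mult_single)

text \<open>Grouping the monomials of \<open>p\<close> by their image collects exactly the
  coefficients of \<open>toric_map p\<close>, so a functional that factors through
  \<open>toric_exp\<close> depends on this image alone.\<close>

lemma pairing_toric_exp:
  "pairing p (g \<circ> toric_exp) =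
    (\<Sum>z\<in>toric_exp ` Poly_Mapping.keys p. g z * Poly_Mapping.lookup (toric_map p) z)"
proof -
  have coeff: "Poly_Mapping.lookup (toric_map p) z =
      (\<Sum>m\<in>{m\<in>Poly_Mapping.keys p. toric_exp m = z}. Poly_Mapping.lookup p m)" for z
    by (simp add: toric_map_eq lookup_sum lookup_single when_def sum.inter_filter)
  have "pairing p (g \<circ> toric_exp) = (\<Sum>z\<in>toric_exp ` Poly_Mapping.keys p.
      \<Sum>m\<in>{m\<in>Poly_Mapping.keys p. toric_exp m = z}. Poly_Mapping.lookup p m * (g \<circ> toric_exp) m)"
    unfolding pairing_def by (rule sum.image_gen) simp
  also have "\<dots> = (\<Sum>z\<in>toric_exp ` Poly_Mapping.keys p. g z * Poly_Mapping.lookup (toric_map p) z)"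
    unfolding coeff sum_distrib_left by (intro sum.cong) auto
  finally show ?thesis .
qed

lemma lookup_toric_map:
  "Poly_Mapping.lookup (toric_map p) z = pairing p ((\<lambda>y. if y = z then 1 else 0) \<circ> toric_exp)"
  by (simp add: toric_map_eq lookup_sum lookup_single when_def pairing_def if_distrib cong: if_cong)

text \<open>The indicator of a fibre of \<open>toric_exp\<close> reads off one coefficient of the
  image, and conversely every function constant on fibres sees only the image. Hence the kernel is
  an annihilator.\<close>

lemma toric_ideal_eq:
  "toric_ideal TYPE('k::field) Q = {p \<in> carrier (mpoly_ring (lattice_points Q)).
    \<forall>h \<in> range (\<lambda>g. g \<circ> toric_exp). pairing p h = (0::'k)}"
proof -
  have "toric_map p = 0 \<longleftrightarrow> (\<forall>g. pairing p (g \<circ> toric_exp) = 0)" for p :: "(int ^ 'a, 'k) mpoly"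
    by (metis (no_types, lifting) lookup_toric_map lookup_zero pairing_toric_exp
        poly_mapping_eqI mult_zero_right sum.neutral)
  then show ?thesis
    by (auto simp: toric_ideal_def a_kernel_def' ring_of_type_algebra_def)
qed

lemma ideal_toric_ideal:
  "ideal (toric_ideal TYPE('k::field) Q) (mpoly_ring (lattice_points Q))"
  unfolding toric_ideal_eq
proof (rule ideal_annihilator)
  fix h :: "(int ^ 'a \<Rightarrow>\<^sub>0 nat) \<Rightarrow> 'k" and w
  assume "h \<in> range (\<lambda>g. g \<circ> toric_exp)"
  then obtain g where "h = g \<circ> toric_exp" by blast
  then have "(\<lambda>m. h (w + m)) = (\<lambda>z. g (toric_exp w + z)) \<circ> toric_exp"
    by (auto simp: toric_exp_add)
  then show "(\<lambda>m. h (w + m)) \<in> range (\<lambda>g. g \<circ> toric_exp)" by blast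
qed

lemma keys_binom: "u \<noteq> v \<Longrightarrow> Poly_Mapping.keys (binom u v :: ('x, 'k::field) mpoly) = {u, v}"
  by (auto simp: binom_def in_keys_iff lookup_minus lookup_single when_def split: if_splits)

lemma keys_binom_subset: "Poly_Mapping.keys (binom u v :: ('x, 'k::field) mpoly) \<subseteq> {u, v}"
  by (auto simp: binom_def in_keys_iff lookup_minus lookup_single when_def split: if_splits)

lemma pairing_binom: "pairing (binom u v) h = h u - h v"
  by (simp add: binom_def pairing_diff pairing_single)

lemma total_degree_binom:
  "u \<noteq> v \<Longrightarrow> total_degree (binom u v :: ('x, 'k::field) mpoly) = max (monomial_degree u) (monomial_degree v)"
  by (simp add: total_degree_def keys_binom)

lemma binom_in_toric_ideal:
  assumes "Poly_Mapping.keys u \<subseteq> lattice_points Q" "Poly_Mapping.keys v \<subseteq> lattice_points Q"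
    "toric_exp u = toric_exp v"
  shows "(binom u v :: (int ^ 'n::finite, 'k::field) mpoly) \<in> toric_ideal TYPE('k) Q"
  using assms keys_binom_subset[of u v] by (fastforce simp: toric_ideal_eq pairing_binom)

lemma binom_in_toric_idealD:
  assumes "(binom u v :: (int ^ 'n::finite, 'k::field) mpoly) \<in> toric_ideal TYPE('k) Q" "u \<noteq> v"
  shows "Poly_Mapping.keys u \<subseteq> lattice_points Q" "Poly_Mapping.keys v \<subseteq> lattice_points Q"
    "toric_exp u = toric_exp v"
proof -
  show "Poly_Mapping.keys u \<subseteq> lattice_points Q" "Poly_Mapping.keys v \<subseteq> lattice_points Q"
    using assms by (auto simp: toric_ideal_eq keys_binom)
  \<comment> \<open>The indicator of the fibre of \<open>u\<close> pairs to 1 with the binomial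
    unless \<open>v\<close> lies in the same fibre.\<close>
  have "pairing (binom u v :: (int ^ 'n, 'k) mpoly) ((\<lambda>z. if z = toric_exp u then 1 else 0) \<circ> toric_exp) = 0"
    using assms by (auto simp: toric_ideal_eq)
  then show "toric_exp u = toric_exp v"
    by (auto simp: pairing_binom split: if_splits)
qed

section \<open>Quadratic generation is connectivity under moves\<close>

lemma tuple_monom_replace_two:
  assumes x: "x \<in> {1..k} \<rightarrow>\<^sub>E B"
    and eq: "tuple_monom k x = w + (Poly_Mapping.single b 1 + Poly_Mapping.single c 1)"
    and B: "b' \<in> B" "c' \<in> B" "b + c = b' + c'"
  obtains y where "(x, y) \<in> tuple_moves B k"
    "tuple_monom k y = w + (Poly_Mapping.single b' 1 + Poly_Mapping.single c' 1)"
proof -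
  have "b \<in> Poly_Mapping.keys (tuple_monom k x)"
    by (simp add: eq keys_add_nat)
  then obtain p where p: "p \<in> {1..k}" "x p = b"
    by (auto simp: keys_tuple_monom)
  have "tuple_monom k x = Poly_Mapping.single b 1 + (\<Sum>i\<in>{1..k} - {p}. Poly_Mapping.single (x i) 1)"
    unfolding tuple_monom_def p(2)[symmetric] using p(1) by (subst sum.remove[of _ p]) auto
  then have "Poly_Mapping.single b 1 + (\<Sum>i\<in>{1..k} - {p}. Poly_Mapping.single (x i) 1)
      = Poly_Mapping.single b 1 + (w + Poly_Mapping.single c 1)"
    using eq by (simp only: add.commute add.left_commute add.assoc)
  then have "(\<Sum>i\<in>{1..k} - {p}. Poly_Mapping.single (x i) 1) = w + Poly_Mapping.single c 1"
    by (rule add_left_imp_eq)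
  \<comment> \<open>The position of \<open>c\<close> is sought only after that of \<open>b\<close>
    has been removed, which gives two distinct positions even when \<open>b = c\<close>.\<close>
  then have "(\<Sum>i\<in>{1..k} - {p}. Poly_Mapping.lookup (Poly_Mapping.single (x i) (1::nat)) c) \<noteq> 0"
    by (simp add: lookup_sum[symmetric] lookup_add)
  then obtain q where "q \<in> {1..k} - {p}" "Poly_Mapping.lookup (Poly_Mapping.single (x q) (1::nat)) c \<noteq> 0"
    by (meson sum.not_neutral_contains_not_neutral)
  then have q: "q \<in> {1..k}" "p \<noteq> q" "x q = c"
    by (auto simp: lookup_single when_def split: if_splits)
  define y where "y = x(p := b', q := c')"
  have y: "y \<in> {1..k} \<rightarrow>\<^sub>E B"
    using x p q B by (auto simp: y_def PiE_def Pi_def extensional_def)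
  have yp: "y p = b'" "y q = c'" using q by (auto simp: y_def)
  have "(x, y) \<in> tuple_moves B k"
    using x y p(1) q(1,2) by (rule tuple_movesI) (use p q B in \<open>auto simp: y_def\<close>)
  moreover have "tuple_monom k y = w + (Poly_Mapping.single b' 1 + Poly_Mapping.single c' 1)"
  proof -
    let ?r = "\<lambda>z. \<Sum>i\<in>{1..k} - {p, q}. Poly_Mapping.single (z i) (1::nat)"
    have "Poly_Mapping.single b 1 + Poly_Mapping.single c 1 + ?r x
      = Poly_Mapping.single b 1 + Poly_Mapping.single c 1 + w"
      using tuple_monom_two[OF p(1) q(1,2), of x] eq p(2) q(3) by (simp add: add.commute)
    then have "?r x = w" by (rule add_left_imp_eq)
    moreover have "?r y = ?r x" by (rule sum.cong) (auto simp: y_def)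
    ultimately show ?thesis
      using tuple_monom_two[OF p(1) q(1,2), of y] by (simp add: yp add.commute)
  qed
  ultimately show ?thesis by (rule that)
qed

lemma degree_two_tuple_monom:
  assumes "monomial_degree m = 2" "Poly_Mapping.keys m \<subseteq> B"
  obtains b c where "b \<in> B" "c \<in> B" "m = Poly_Mapping.single b 1 + Poly_Mapping.single c 1"
proof -
  from ex_tuple_monom[OF assms(2)] assms(1) obtain x where x: "x \<in> {1..2} \<rightarrow>\<^sub>E B" "m = tuple_monom 2 x"
    by auto
  have "m = Poly_Mapping.single (x 1) 1 + Poly_Mapping.single (x 2) 1"
    unfolding x(2) by (subst tuple_monom_two[of 1 _ 2]) (auto intro!: sum.neutral)
  moreover have "x 1 \<in> B" "x 2 \<in> B" using x(1) by auto
  ultimately show ?thesis using that by blast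
qed

text \<open>The generators lie in the annihilator \<open>J\<close> of all move-invariant functions,
  so the whole toric ideal does. For two tuples with equal sum the difference of their monomials is
  in the toric ideal, and no invariant function can separate them.\<close>

lemma quad_connected_if_generated:
  fixes Q :: "(real ^ 'n::finite) set"
  assumes "generated_by_quadratic_binomials (lattice_points Q) (toric_ideal TYPE('k::field) Q)"
  shows "quad_connected (lattice_points Q)"
proof -
  let ?B = "lattice_points Q" and ?I = "toric_ideal TYPE('k) Q"
  let ?R = "mpoly_ring ?B :: (int ^ 'n, 'k) mpoly ring"
  interpret R: cring ?R by (rule cring_mpoly_ring)
  have "\<exists>F \<subseteq> carrier ?R. (\<forall>p\<in>F. is_binomial p \<and> total_degree p = 2) \<and> ?I = genideal ?R F"
    using assms by (simp only: generated_by_quadratic_binomials_def)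
  then obtain F where F: "F \<subseteq> carrier ?R" "\<forall>p\<in>F. is_binomial p \<and> total_degree p = 2"
    and I: "?I = genideal ?R F"
    by (elim exE conjE) (rule that)
  define H :: "((int ^ 'n \<Rightarrow>\<^sub>0 nat) \<Rightarrow> 'k) set" where
    "H = {h. \<forall>b\<in>?B. \<forall>c\<in>?B. \<forall>b'\<in>?B. \<forall>c'\<in>?B. \<forall>w. b + c = b' + c' \<longrightarrow>
      h (w + (Poly_Mapping.single b 1 + Poly_Mapping.single c 1)) =
      h (w + (Poly_Mapping.single b' 1 + Poly_Mapping.single c' 1))}"
  define J where "J = {p \<in> carrier ?R. \<forall>h\<in>H. pairing p h = 0}"
  have "ideal J ?R"
    unfolding J_def
  proof (rule ideal_annihilator)
    fix h w assume "h \<in> H"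
    then have "h (w + v + (Poly_Mapping.single b 1 + Poly_Mapping.single c 1)) =
        h (w + v + (Poly_Mapping.single b' 1 + Poly_Mapping.single c' 1))"
      if "b \<in> ?B" "c \<in> ?B" "b' \<in> ?B" "c' \<in> ?B" "b + c = b' + c'" for b c b' c' v
      using that unfolding H_def by blast
    then show "(\<lambda>m. h (w + m)) \<in> H"
      unfolding H_def mem_Collect_eq add.assoc[of w] by blast
  qed
  moreover have "F \<subseteq> J"
  proof
    fix p assume p: "p \<in> F"
    then obtain u v where uv: "u \<noteq> v" "p = binom u v"
      using F(2) unfolding is_binomial_def binom_def by blast
    have "p \<in> ?I" using p R.genideal_self[OF F(1)] unfolding I by blast
    then have keys: "Poly_Mapping.keys u \<subseteq> ?B" "Poly_Mapping.keys v \<subseteq> ?B"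
      and exp: "toric_exp u = toric_exp v"
      using binom_in_toric_idealD uv by blast+
    \<comment> \<open>The exponent of \<open>s\<close> makes the two monomials have the same degree,
      so total degree 2 determines both degrees.\<close>
    from exp have "monomial_degree u = monomial_degree v"
      by (simp flip: toric_exp_degree)
    then have deg: "monomial_degree u = 2" "monomial_degree v = 2"
      using F(2) p uv by (auto simp: total_degree_binom)
    obtain b c where u: "b \<in> ?B" "c \<in> ?B" "u = Poly_Mapping.single b 1 + Poly_Mapping.single c 1"
      using degree_two_tuple_monom[OF deg(1) keys(1)] .
    obtain b' c' where v: "b' \<in> ?B" "c' \<in> ?B" "v = Poly_Mapping.single b' 1 + Poly_Mapping.single c' 1"
      using degree_two_tuple_monom[OF deg(2) keys(2)] .
    have eq: "b + c = b' + c'"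
      using exp unfolding u(3) v(3) by (simp add: toric_exp_add toric_exp_single del: One_nat_def)
    have "h u = h v" if "h \<in> H" for h
    proof -
      have "h (0 + u) = h (0 + v)"
        using that u v eq unfolding H_def by blast
      then show ?thesis by simp
    qed
    then show "p \<in> J"
      using p F(1) by (auto simp: J_def uv(2) pairing_binom)
  qed
  ultimately have IJ: "?I \<subseteq> J"
    unfolding I by (rule R.genideal_minimal)
  show ?thesis
    unfolding quad_connected_def
  proof (intro allI ballI impI)
    fix k :: nat and x y :: "nat \<Rightarrow> int ^ 'n"
    assume x: "x \<in> {1..k} \<rightarrow>\<^sub>E ?B" and y: "y \<in> {1..k} \<rightarrow>\<^sub>E ?B" and sum: "sum x {1..k} = sum y {1..k}"
    \<comment> \<open>The indicator of the class of \<open>x\<close>, taken on monomials: a monomial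
      counts as soon as one of its orderings is reachable.\<close>
    define h :: "(int ^ 'n \<Rightarrow>\<^sub>0 nat) \<Rightarrow> 'k" where
      "h m = (if \<exists>z. (x, z) \<in> (tuple_moves ?B k)\<^sup>* \<and> m = tuple_monom k z then 1 else 0)" for m
    have step: "\<exists>z. (x, z) \<in> (tuple_moves ?B k)\<^sup>* \<and> w + (Poly_Mapping.single b' 1 + Poly_Mapping.single c' 1) = tuple_monom k z"
      if bc: "b' \<in> ?B" "c' \<in> ?B" "b + c = b' + c'"
        and z: "(x, z) \<in> (tuple_moves ?B k)\<^sup>*" "w + (Poly_Mapping.single b 1 + Poly_Mapping.single c 1) = tuple_monom k z"
      for b c b' c' w z
    proof -
      have "z \<in> {1..k} \<rightarrow>\<^sub>E ?B" using tuple_moves_rtrancl_tuple[OF z(1) x] .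
      from tuple_monom_replace_two[OF this z(2)[symmetric] bc] obtain z' where
        "(z, z') \<in> tuple_moves ?B k" "tuple_monom k z' = w + (Poly_Mapping.single b' 1 + Poly_Mapping.single c' 1)" .
      with z(1) show ?thesis by (metis rtrancl_into_rtrancl)
    qed
    have "h \<in> H"
      unfolding H_def h_def mem_Collect_eq
    proof (intro ballI allI impI)
      fix b c b' c' w
      assume bc: "b \<in> ?B" "c \<in> ?B" "b' \<in> ?B" "c' \<in> ?B" "b + c = b' + c'"
      show "(if \<exists>z. (x, z) \<in> (tuple_moves ?B k)\<^sup>* \<and> w + (Poly_Mapping.single b 1 + Poly_Mapping.single c 1) = tuple_monom k z then 1 else 0) =
        (if \<exists>z. (x, z) \<in> (tuple_moves ?B k)\<^sup>* \<and> w + (Poly_Mapping.single b' 1 + Poly_Mapping.single c' 1) = tuple_monom k z then 1 else (0::'k))"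
        using step[OF bc(3,4,5)] step[OF bc(1,2) bc(5)[symmetric]] by (intro if_cong) blast+
    qed
    moreover have "binom (tuple_monom k x) (tuple_monom k y) \<in> ?I"
      using x y sum by (intro binom_in_toric_ideal) (auto simp: keys_tuple_monom toric_exp_tuple_monom)
    ultimately have "h (tuple_monom k x) = h (tuple_monom k y)"
      using IJ by (auto simp: J_def pairing_binom)
    moreover have "h (tuple_monom k x) = 1"
      by (auto simp: h_def)
    ultimately obtain z where z: "(x, z) \<in> (tuple_moves ?B k)\<^sup>*" "tuple_monom k y = tuple_monom k z"
      by (auto simp: h_def split: if_splits)
    \<comment> \<open>So far \<open>z\<close> and \<open>y\<close> agree only as monomials; the
      remaining permutation is a sequence of moves as well.\<close>
    have "(z, y) \<in> (tuple_moves ?B k)\<^sup>*"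
      using tuple_moves_rtrancl_tuple[OF z(1) x] y
      by (rule same_fibres_connected) (simp only: z(2) flip: lookup_tuple_monom)
    with z(1) show "(x, y) \<in> (tuple_moves ?B k)\<^sup>*" by (rule rtrancl_trans)
  qed
qed

text \<open>A path of moves telescopes into multiples of quadratic binomials, so every binomial of
  the toric ideal lies in \<open>J\<close>. A general element is reduced to 0 by subtracting scalar
  multiples of such binomials, each of which removes a term.\<close>

lemma generated_if_quad_connected:
  fixes Q :: "(real ^ 'n::finite) set"
  assumes conn: "quad_connected (lattice_points Q)"
  shows "generated_by_quadratic_binomials (lattice_points Q) (toric_ideal TYPE('k::field) Q)"
proof -
  let ?B = "lattice_points Q" and ?I = "toric_ideal TYPE('k) Q"
  let ?R = "mpoly_ring ?B :: (int ^ 'n, 'k) mpoly ring"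
  interpret R: cring ?R by (rule cring_mpoly_ring)
  interpret I: ideal ?I ?R by (rule ideal_toric_ideal)
  define F where "F = {p \<in> ?I. is_binomial p \<and> total_degree p = 2}"
  have F: "F \<subseteq> carrier ?R" using I.a_subset unfolding F_def by blast
  define J where "J = genideal ?R F"
  interpret J: ideal J ?R unfolding J_def by (rule R.genideal_ideal[OF F])
  have J0: "0 \<in> J" using J.zero_closed by simp
  have Jadd: "p + q \<in> J" if "p \<in> J" "q \<in> J" for p q
    using J.a_closed[OF that] by simp
  have Jmult: "p * q \<in> J" if "q \<in> J" "p \<in> carrier ?R" for p q
    using J.I_l_closed[OF that] by simp
  have step: "binom (tuple_monom k x) (tuple_monom k y) \<in> J" if "(x, y) \<in> tuple_moves ?B k" for k x y
    using that
  proof (rule tuple_movesE)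
    fix p q
    assume x: "x \<in> {1..k} \<rightarrow>\<^sub>E ?B" and y: "y \<in> {1..k} \<rightarrow>\<^sub>E ?B"
      and pq: "p \<in> {1..k}" "q \<in> {1..k}" "p \<noteq> q" "x p + x q = y p + y q"
      and eq: "\<And>i. i \<noteq> p \<Longrightarrow> i \<noteq> q \<Longrightarrow> x i = y i"
    define r where "r = (\<Sum>i\<in>{1..k} - {p, q}. Poly_Mapping.single (x i) (1::nat))"
    define u where "u = Poly_Mapping.single (x p) 1 + Poly_Mapping.single (x q) (1::nat)"
    define v where "v = Poly_Mapping.single (y p) 1 + Poly_Mapping.single (y q) (1::nat)"
    have mx: "tuple_monom k x = r + u"
      using tuple_monom_two[OF pq(1-3), of x] by (simp add: r_def u_def add.commute)
    have "r = (\<Sum>i\<in>{1..k} - {p, q}. Poly_Mapping.single (y i) (1::nat))"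
      unfolding r_def by (rule sum.cong) (auto simp: eq)
    then have my: "tuple_monom k y = r + v"
      using tuple_monom_two[OF pq(1-3), of y] by (simp add: v_def add.commute)
    have "binom (tuple_monom k x) (tuple_monom k y) = Poly_Mapping.single r 1 * (binom u v :: (int ^ 'n, 'k) mpoly)"
      by (simp add: mx my binom_def right_diff_distrib mult_single)
    moreover have "Poly_Mapping.single r 1 \<in> carrier ?R"
    proof -
      have "Poly_Mapping.keys r \<subseteq> x ` {1..k}"
        using keys_tuple_monom[of k x] unfolding mx keys_add_nat by blast
      also have "\<dots> \<subseteq> ?B" using x by auto
      finally show ?thesis by simp
    qed
    moreover have "binom u v \<in> J"
    \<comment> \<open>A move may merely reorder two entries. The difference is then 0, which is not
      a binomial in the sense of \<open>is_binomial\<close> and hence not in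
      \<open>F\<close>.\<close>
    proof (cases "u = v")
      case True
      then show ?thesis using J0 by (simp add: binom_def)
    next
      case False
      have "Poly_Mapping.keys u \<subseteq> ?B" "Poly_Mapping.keys v \<subseteq> ?B"
        using x y pq(1,2) by (auto simp: u_def v_def keys_add_nat)
      moreover have "toric_exp u = toric_exp v"
        using pq(4) by (simp add: u_def v_def toric_exp_add toric_exp_single del: One_nat_def)
      ultimately have "binom u v \<in> ?I" by (rule binom_in_toric_ideal)
      moreover have "monomial_degree u = 2" "monomial_degree v = 2"
        by (simp_all add: u_def v_def monomial_degree_add monomial_degree_single)
      ultimately have "binom u v \<in> F"
        using False by (auto simp: F_def is_binomial_def binom_def[symmetric] total_degree_binom)
      then show ?thesis using R.genideal_self[OF F] by (auto simp: J_def)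
    qed
    ultimately show ?thesis using Jmult by metis
  qed
  have chain: "binom (tuple_monom k x) (tuple_monom k y) \<in> J" if "(x, y) \<in> (tuple_moves ?B k)\<^sup>*" for k x y
    using that
  proof (induction rule: rtrancl_induct)
    case base
    show ?case using J0 by (simp add: binom_def)
  next
    case (step y z)
    have "binom (tuple_monom k x) (tuple_monom k z) = binom (tuple_monom k x) (tuple_monom k y) + (binom (tuple_monom k y) (tuple_monom k z) :: (int ^ 'n, 'k) mpoly)"
      by (simp add: binom_def)
    with step.IH \<open>(y, z) \<in> tuple_moves ?B k\<close> \<open>\<And>k x y. (x, y) \<in> tuple_moves ?B k \<Longrightarrow> _\<close> Jadd
    show ?case by metis
  qed
  have binoms: "binom u v \<in> J"
    if "Poly_Mapping.keys u \<subseteq> ?B" "Poly_Mapping.keys v \<subseteq> ?B" "toric_exp u = toric_exp v" for u v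
  proof -
    from ex_tuple_monom[OF that(1)] obtain k x where x: "x \<in> {1..k} \<rightarrow>\<^sub>E ?B" "u = tuple_monom k x" by blast
    from ex_tuple_monom[OF that(2)] obtain l y where y: "y \<in> {1..l} \<rightarrow>\<^sub>E ?B" "v = tuple_monom l y" by blast
    have "l = k" "sum x {1..k} = sum y {1..k}"
      using that(3) by (auto simp: x y toric_exp_tuple_monom)
    then have "(x, y) \<in> (tuple_moves ?B k)\<^sup>*"
      using conn x(1) y(1) unfolding quad_connected_def by blast
    then show ?thesis using chain x(2) y(2) \<open>l = k\<close> by blast
  qed
  have "p \<in> J" if "p \<in> ?I" for p
    using that
  proof (induction "card (Poly_Mapping.keys p)" arbitrary: p rule: less_induct)
    case less
    show ?case
    proof (cases "p = 0")
      case True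
      then show ?thesis using J0 by simp
    next
      case False
      then obtain m where m: "m \<in> Poly_Mapping.keys p"
        by (metis poly_mapping_eqI in_keys_iff lookup_zero)
      \<comment> \<open>The coefficient of a monomial alone in its fibre would survive in the image
        of \<open>p\<close>.\<close>
      have "\<exists>m'\<in>Poly_Mapping.keys p. m' \<noteq> m \<and> toric_exp m' = toric_exp m"
      proof (rule ccontr)
        assume neg: "\<not> ?thesis"
        let ?h = "(\<lambda>z. if z = toric_exp m then 1 else 0) \<circ> toric_exp"
        have "pairing p ?h = (\<Sum>m'\<in>Poly_Mapping.keys p. if m' = m then Poly_Mapping.lookup p m else 0)"
          unfolding pairing_def using neg by (intro sum.cong) auto
        also have "\<dots> = Poly_Mapping.lookup p m" using m by simp
        finally show False
          using less.prems m by (auto simp: toric_ideal_eq in_keys_iff)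
      qed
      then obtain m' where m': "m' \<in> Poly_Mapping.keys p" "m' \<noteq> m" "toric_exp m' = toric_exp m"
        by blast
      define c where "c = Poly_Mapping.lookup p m"
      have pcar: "p \<in> carrier ?R" using less.prems I.a_subset by blast
      then have keys: "Poly_Mapping.keys m \<subseteq> ?B" "Poly_Mapping.keys m' \<subseteq> ?B"
        using m m' by auto
      define b where "b = Poly_Mapping.single 0 (- c) * (binom m m' :: (int ^ 'n, 'k) mpoly)"
      have const: "Poly_Mapping.single 0 d \<in> carrier ?R" for d by simp
      have "p + b \<in> ?I"
        using less.prems I.I_l_closed[OF binom_in_toric_ideal[OF keys m'(3)[symmetric]] const]
          I.a_closed unfolding b_def by simp
      moreover have look: "Poly_Mapping.lookup (p + b) n =
          Poly_Mapping.lookup p n - (c when n = m) + (c when n = m')" for n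
        by (simp add: b_def binom_def right_diff_distrib mult_single lookup_add lookup_minus
            lookup_single when_def)
      \<comment> \<open>The coefficient of \<open>m\<close> is shifted onto \<open>m'\<close>, which
        already occurs in \<open>p\<close>: the term \<open>m\<close> disappears and no new term
        arises.\<close>
      have "Poly_Mapping.keys (p + b) \<subset> Poly_Mapping.keys p"
      proof
        show "Poly_Mapping.keys (p + b) \<subseteq> Poly_Mapping.keys p"
          using m m' by (auto simp: in_keys_iff look when_def split: if_splits)
        have "m \<notin> Poly_Mapping.keys (p + b)"
          using m' by (auto simp: in_keys_iff look when_def c_def)
        with m show "Poly_Mapping.keys (p + b) \<noteq> Poly_Mapping.keys p" by blast
      qed
      then have "card (Poly_Mapping.keys (p + b)) < card (Poly_Mapping.keys p)"
        by (intro psubset_card_mono) auto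
      ultimately have "p + b \<in> J" using less.hyps by blast
      moreover have "Poly_Mapping.single 0 c * binom m m' \<in> J"
        using binoms[OF keys m'(3)[symmetric]] by (rule Jmult) simp
      moreover have "p = (p + b) + Poly_Mapping.single 0 c * binom m m'"
        by (simp add: b_def single_uminus)
      ultimately show ?thesis using Jadd by metis
    qed
  qed
  moreover have "J \<subseteq> ?I"
    unfolding J_def by (rule R.genideal_minimal) (auto simp: F_def ideal_toric_ideal)
  ultimately have "?I = genideal ?R F" unfolding J_def by blast
  moreover have "\<forall>p\<in>F. is_binomial p \<and> total_degree p = 2" by (simp add: F_def)
  ultimately show ?thesis
    unfolding generated_by_quadratic_binomials_def using F by blast
qed

lemma generated_iff_quad_connected:
  fixes Q :: "(real ^ 'n::finite) set"
  shows "generated_by_quadratic_binomials (lattice_points Q) (toric_ideal TYPE('k::field) Q)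
    \<longleftrightarrow> quad_connected (lattice_points Q)"
  using quad_connected_if_generated generated_if_quad_connected by blast

section \<open>Lattice points of the stable set polytopes\<close>

definition signed_stable_vecs :: "'n::finite set set \<Rightarrow> (int ^ 'n) set" where
  "signed_stable_vecs E = {b. (\<forall>i. b $ i \<in> {-1, 0, 1}) \<and> stable_set UNIV E {i. b $ i \<noteq> 0}}"

definition stable_vecs :: "'n::finite set set \<Rightarrow> (int ^ 'n) set" where
  "stable_vecs E = {b. (\<forall>i. b $ i \<in> {0, 1}) \<and> stable_set UNIV E {i. b $ i \<noteq> 0}}"

lemma indicator_vec_nth: "indicator_vec S $ i = of_bool (i \<in> S)"
  by (simp add: indicator_vec_def axis_def of_bool_def if_distrib cong: if_cong)

lemma stable_set_subset: "stable_set V E S \<Longrightarrow> T \<subseteq> S \<Longrightarrow> stable_set V E T"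
  unfolding stable_set_def by blast

text \<open>Each inequality defines a convex set and holds at the indicator vectors of stable sets.
  The box and edge inequalities do not describe the polytope of a general graph, but they determine
  its integral points.\<close>

lemma stable_set_polytope_bounds:
  assumes "x \<in> stable_set_polytope E"
  shows "0 \<le> x $ i" "x $ i \<le> 1" "{u, v} \<in> E \<Longrightarrow> u \<noteq> v \<Longrightarrow> x $ u + x $ v \<le> 1"
proof -
  have "stable_set_polytope E \<subseteq> {x. 0 \<le> x $ i}"
    unfolding stable_set_polytope_def
    by (rule hull_minimal)
      (auto simp: indicator_vec_nth convex_alt intro!: add_nonneg_nonneg mult_nonneg_nonneg)
  then show "0 \<le> x $ i" using assms by blast
  have "stable_set_polytope E \<subseteq> {x. x $ i \<le> 1}"
    unfolding stable_set_polytope_def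
    by (rule hull_minimal) (auto simp: indicator_vec_nth convex_alt intro!: convex_bound_le)
  then show "x $ i \<le> 1" using assms by blast
  show "x $ u + x $ v \<le> 1" if "{u, v} \<in> E" "u \<noteq> v"
  proof -
    have "{u, v} \<subseteq> S" if "u \<in> S" "v \<in> S" for S using that by blast
    with that have "\<not> (u \<in> S \<and> v \<in> S)" if "stable_set UNIV E S" for S
      using that unfolding stable_set_def by blast
    moreover have "convex {x. x $ u + x $ v \<le> (1::real)}"
    proof (rule convexI, clarsimp)
      fix x y :: "real ^ 'a" and s t :: real
      assume "x $ u + x $ v \<le> 1" "y $ u + y $ v \<le> 1" "0 \<le> s" "0 \<le> t" "s + t = 1"
      then have "s * (x $ u + x $ v) + t * (y $ u + y $ v) \<le> 1"
        by (intro convex_bound_le)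
      then show "s * x $ u + t * y $ u + (s * x $ v + t * y $ v) \<le> 1"
        by (simp add: algebra_simps)
    qed
    ultimately have "stable_set_polytope E \<subseteq> {x. x $ u + x $ v \<le> 1}"
      unfolding stable_set_polytope_def by (intro hull_minimal) (auto simp: indicator_vec_nth)
    then show ?thesis using assms by blast
  qed
qed

text \<open>The box inequalities leave only 0 and 1 for an integral coordinate, and an edge inside
  the support would violate its edge inequality. Real vectors with integral entries are used so that
  the lemma also applies after a change of signs.\<close>

lemma stable_polytope_supportD:
  assumes E: "simple_graph UNIV E" and x: "x \<in> stable_set_polytope E"
    and int: "\<And>i. x $ i \<in> \<int>"
  shows "x $ i \<in> {0, 1}" "stable_set UNIV E {i. x $ i \<noteq> 0}"
proof -
  show x01: "x $ i \<in> {0, 1}" for i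
  proof -
    obtain z where "x $ i = of_int z" using int[of i] by (rule Ints_cases)
    with stable_set_polytope_bounds(1,2)[OF x, of i] show ?thesis by auto
  qed
  have "\<not> e \<subseteq> {i. x $ i \<noteq> 0}" if "e \<in> E" for e
  proof
    assume sub: "e \<subseteq> {i. x $ i \<noteq> 0}"
    from E that have "card e = 2" by (auto simp: simple_graph_def)
    then obtain u v where uv: "e = {u, v}" "u \<noteq> v" by (meson card_2_iff)
    then have "x $ u = 1" "x $ v = 1" using sub x01[of u] x01[of v] by auto
    then show False using stable_set_polytope_bounds(3)[OF x, of u v] uv that by simp
  qed
  then show "stable_set UNIV E {i. x $ i \<noteq> 0}" by (simp add: stable_set_def)
qed

lemma indicator_vec_in_polytope: "stable_set UNIV E S \<Longrightarrow> indicator_vec S \<in> stable_set_polytope E"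
  unfolding stable_set_polytope_def by (rule hull_inc) blast

lemma lattice_points_stable_set_polytope:
  assumes E: "simple_graph UNIV E"
  shows "lattice_points (stable_set_polytope E) = stable_vecs E"
proof (intro Set.equalityI subsetI)
  fix b assume "b \<in> lattice_points (stable_set_polytope E)"
  then have "(\<chi> i. real_of_int (b $ i)) \<in> stable_set_polytope E"
    by (simp add: lattice_points_def)
  note D = stable_polytope_supportD[OF E this]
  show "b \<in> stable_vecs E"
    using D(1) D(2) by (simp add: stable_vecs_def)
next
  fix b assume b: "b \<in> stable_vecs E"
  then have "(\<chi> i. real_of_int (b $ i)) = indicator_vec {i. b $ i \<noteq> 0}"
    by (auto simp: vec_eq_iff indicator_vec_nth stable_vecs_def)
  then show "b \<in> lattice_points (stable_set_polytope E)"
    using b indicator_vec_in_polytope[of E "{i. b $ i \<noteq> 0}"]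
    by (simp add: lattice_points_def stable_vecs_def)
qed

lemma lattice_points_sym_stable_set_polytope:
  assumes E: "simple_graph UNIV E"
  shows "lattice_points (sym_stable_set_polytope E) = signed_stable_vecs E"
proof (intro Set.equalityI subsetI)
  fix b assume "b \<in> lattice_points (sym_stable_set_polytope E)"
  then obtain \<epsilon> x where eps: "\<And>i. \<epsilon> $ i \<in> {-1, 1}" and x: "x \<in> stable_set_polytope E"
    and b: "\<And>i. real_of_int (b $ i) = \<epsilon> $ i * x $ i"
    unfolding lattice_points_def sym_stable_set_polytope_def by (auto simp: vec_eq_iff)
  \<comment> \<open>Signs square to 1, so the point of the unsigned polytope is recovered from
    \<open>b\<close> and inherits its integrality.\<close>
  have xb: "x $ i = \<epsilon> $ i * real_of_int (b $ i)" for i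
    using eps[of i] b[of i] by auto
  have "x $ i \<in> \<int>" for i using eps[of i] xb[of i] by auto
  note D = stable_polytope_supportD[OF E x this]
  have "x $ i = 0 \<longleftrightarrow> b $ i = 0" for i using eps[of i] xb[of i] by auto
  moreover have "b $ i \<in> {-1, 0, 1}" for i
    using D(1)[of i] eps[of i] b[of i] by auto
  ultimately show "b \<in> signed_stable_vecs E"
    using D(2) by (simp add: signed_stable_vecs_def)
next
  fix b assume b: "b \<in> signed_stable_vecs E"
  let ?x = "indicator_vec {i. b $ i \<noteq> 0}"
  let ?e = "\<chi> i. if b $ i = -1 then -1 else (1::real)"
  have "?x \<in> stable_set_polytope E"
    using b by (intro indicator_vec_in_polytope) (simp add: signed_stable_vecs_def)
  moreover have "(\<chi> i. real_of_int (b $ i)) = (\<chi> i. ?e $ i * ?x $ i)"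
    using b by (auto simp: vec_eq_iff indicator_vec_nth signed_stable_vecs_def)
  moreover have "\<forall>i. ?e $ i \<in> {-1, 1}" by simp
  ultimately show "b \<in> lattice_points (sym_stable_set_polytope E)"
    unfolding lattice_points_def sym_stable_set_polytope_def by blast
qed

section \<open>Signed stable sets\<close>

text \<open>A relation, because it is left open which entries 1 are deleted. The equality of sums
  encodes the count: with entries -1, 0, 1 in \<open>c\<close>, the ones kept at a vertex number its
  entries 1 minus its entries -1.\<close>

definition reduction :: "nat \<Rightarrow> (nat \<Rightarrow> int ^ 'n) \<Rightarrow> (nat \<Rightarrow> int ^ 'n) \<Rightarrow> bool" where
  "reduction k c M \<longleftrightarrow> M \<in> {1..k} \<rightarrow>\<^sub>E UNIV \<and> (\<forall>i\<in>{1..k}. \<forall>v. M i $ v = 0 \<or> M i $ v = 1 \<and> c i $ v = 1)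
    \<and> sum M {1..k} = sum c {1..k}"

lemma stable_vecs_mono:
  assumes "b \<in> signed_stable_vecs E" "\<And>v. a $ v = 0 \<or> a $ v = 1 \<and> b $ v = 1"
  shows "a \<in> stable_vecs E"
proof -
  have "{v. a $ v \<noteq> 0} \<subseteq> {v. b $ v \<noteq> 0}" using assms(2) by fastforce
  with assms stable_set_subset show ?thesis
    unfolding signed_stable_vecs_def stable_vecs_def by blast
qed

lemma reduction_tuple:
  assumes "c \<in> {1..k} \<rightarrow>\<^sub>E signed_stable_vecs E" "reduction k c M"
  shows "M \<in> {1..k} \<rightarrow>\<^sub>E stable_vecs E"
proof (rule PiE_I)
  fix i assume i: "i \<in> {1..k}"
  then have "c i \<in> signed_stable_vecs E" using assms(1) by blast
  then show "M i \<in> stable_vecs E"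
    by (rule stable_vecs_mono) (use assms(2) i in \<open>auto simp: reduction_def\<close>)
qed (use assms(2) in \<open>auto simp: reduction_def PiE_def extensional_def\<close>)

lemma reductionD_sum:
  "reduction k c M \<Longrightarrow> (\<Sum>i\<in>{1..k}. M i $ v) = (\<Sum>i\<in>{1..k}. c i $ v)"
  unfolding reduction_def by (metis sum_component)

text \<open>Where \<open>M\<close> and \<open>N\<close> differ at \<open>v\<close>, equal sums give
  an index \<open>i\<close> at which only \<open>M\<close> has a 1 and an index \<open>j\<close> at
  which only \<open>N\<close> has one. Moving the unit vector of \<open>v\<close> from
  \<open>i\<close> to \<open>j\<close> brings \<open>M\<close> closer to \<open>N\<close>; stability
  is never at risk, since all supports stay inside those of \<open>c\<close>.\<close>

lemma reductions_connected:
  fixes c :: "nat \<Rightarrow> int ^ 'n::finite"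
  assumes c: "c \<in> {1..k} \<rightarrow>\<^sub>E signed_stable_vecs E" and N: "reduction k c N"
  shows "reduction k c M \<Longrightarrow> (M, N) \<in> (tuple_moves (stable_vecs E) k)\<^sup>*"
proof (induction "card {(i, v). i \<in> {1..k} \<and> M i $ v \<noteq> N i $ v}" arbitrary: M rule: less_induct)
  case less
  have fin: "finite {(i, v). i \<in> {1..k} \<and> P i (v :: 'n)}" for P
    by (rule finite_subset[of _ "{1..k} \<times> UNIV"]) auto
  show ?case
  proof (cases "\<exists>i\<in>{1..k}. \<exists>v. M i $ v \<noteq> N i $ v")
    case False
    have "M \<in> {1..k} \<rightarrow>\<^sub>E UNIV" "N \<in> {1..k} \<rightarrow>\<^sub>E UNIV"
      using less.prems N by (simp_all only: reduction_def)
    moreover have "M i = N i" if "i \<in> {1..k}" for i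
      using False that unfolding vec_eq_iff by blast
    ultimately have "M = N" by (rule PiE_ext)
    then show ?thesis by simp
  next
    case True
    then obtain i' v where i': "i' \<in> {1..k}" "M i' $ v \<noteq> N i' $ v" by blast
    have M01: "M l $ u \<in> {0, 1}" and N01: "N l $ u \<in> {0, 1}" if "l \<in> {1..k}" for l u
      using less.prems N that unfolding reduction_def by blast+
    have sums: "(\<Sum>l\<in>{1..k}. M l $ v) = (\<Sum>l\<in>{1..k}. N l $ v)"
      using reductionD_sum[OF less.prems] reductionD_sum[OF N] by simp
    have "\<exists>i\<in>{1..k}. M i $ v > N i $ v"
    proof (rule ccontr)
      assume "\<not> ?thesis"
      then have "(\<Sum>l\<in>{1..k}. M l $ v) < (\<Sum>l\<in>{1..k}. N l $ v)"
        using i' by (intro sum_strict_mono_ex1) force+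
      then show False using sums by simp
    qed
    then obtain i where i: "i \<in> {1..k}" "M i $ v = 1" "N i $ v = 0"
      using M01 N01 by (metis empty_iff insert_iff less_irrefl not_one_less_zero)
    have "\<exists>j\<in>{1..k}. M j $ v < N j $ v"
    proof (rule ccontr)
      assume "\<not> ?thesis"
      then have "(\<Sum>l\<in>{1..k}. N l $ v) < (\<Sum>l\<in>{1..k}. M l $ v)"
        using i by (intro sum_strict_mono_ex1) force+
      then show False using sums by simp
    qed
    then obtain j where j: "j \<in> {1..k}" "M j $ v = 0" "N j $ v = 1"
      using M01 N01 by (metis empty_iff insert_iff less_irrefl not_one_less_zero)
    have ij: "i \<noteq> j" using i j by auto
    define M' where "M' = M(i := M i - axis v 1, j := M j + axis v 1)"
    have M'_nth: "M' l $ u = (if l = i \<and> u = v then 0 else if l = j \<and> u = v then 1 else M l $ u)" for l u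
      using i j ij by (auto simp: M'_def axis_def)
    have M'ij: "M i + M j = M' i + M' j"
      using ij by (simp add: M'_def)
    have M'_PiE: "M' \<in> {1..k} \<rightarrow>\<^sub>E UNIV"
      using less.prems i(1) j(1) by (auto simp: reduction_def M'_def PiE_def extensional_def)
    have sumM': "sum M' {1..k} = sum M {1..k}"
    proof -
      have "sum M' ({1..k} - {i, j}) = sum M ({1..k} - {i, j})"
        by (rule sum.cong) (auto simp: M'_def)
      then show ?thesis
        unfolding sum_two_diff[OF i(1) j(1) ij] M'ij by simp
    qed
    \<comment> \<open>Applied at \<open>j\<close> and \<open>v\<close>, this shows that
      \<open>c\<close> permits the entry 1 that is moved there.\<close>
    have N1: "N l $ u = 1 \<Longrightarrow> c l $ u = 1" if "l \<in> {1..k}" for l u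
      using N that unfolding reduction_def by force
    have red: "reduction k c M'"
      unfolding reduction_def
    proof (intro conjI M'_PiE ballI allI)
      show "sum M' {1..k} = sum c {1..k}" using less.prems sumM' by (simp add: reduction_def)
      show "M' l $ u = 0 \<or> M' l $ u = 1 \<and> c l $ u = 1" if "l \<in> {1..k}" for l u
        using less.prems that j N1[OF j(1,3)] unfolding reduction_def M'_nth by auto
    qed
    have move: "(M, M') \<in> tuple_moves (stable_vecs E) k"
      using reduction_tuple[OF c less.prems] reduction_tuple[OF c red] i(1) j(1) ij M'ij
      by (rule tuple_movesI) (auto simp: M'_def)
    have "M l $ u \<noteq> N l $ u" if "M' l $ u \<noteq> N l $ u" for l u
      using that i j by (auto simp: M'_nth split: if_splits)
    moreover have "M' i $ v = N i $ v" "M i $ v \<noteq> N i $ v"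
      using i by (simp_all add: M'_nth)
    ultimately have "{(l, u). l \<in> {1..k} \<and> M' l $ u \<noteq> N l $ u} \<subset> {(l, u). l \<in> {1..k} \<and> M l $ u \<noteq> N l $ u}"
      using i(1) by blast
    then have "card {(l, u). l \<in> {1..k} \<and> M' l $ u \<noteq> N l $ u} < card {(l, u). l \<in> {1..k} \<and> M l $ u \<noteq> N l $ u}"
      by (intro psubset_card_mono fin)
    then have "(M', N) \<in> (tuple_moves (stable_vecs E) k)\<^sup>*"
      using less.hyps red by blast
    with move show ?thesis by (rule converse_rtrancl_into_rtrancl)
  qed
qed

text \<open>Where the entries at \<open>p\<close> and \<open>q\<close> cancel, the other entries
  already have the full sum. Entries are at most 1, so at least that many of them are equal to 1 and
  can be kept instead.\<close>

lemma reduction_avoiding_cancelled: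
  fixes c :: "nat \<Rightarrow> int ^ 'n::finite"
  assumes nonneg: "\<And>v. 0 \<le> (\<Sum>i\<in>{1..k}. c i $ v)"
    and c: "\<And>i v. i \<in> {1..k} \<Longrightarrow> c i $ v \<le> 1"
    and pq: "p \<in> {1..k}" "q \<in> {1..k}" "p \<noteq> q"
  obtains M where "reduction k c M" "\<And>v. c p $ v + c q $ v = 0 \<Longrightarrow> M p $ v = 0 \<and> M q $ v = 0"
proof -
  define D where "D v = (if c p $ v + c q $ v = 0 then {p, q} else {})" for v
  have "\<exists>K. K \<subseteq> {i\<in>{1..k} - D v. c i $ v = 1} \<and> int (card K) = (\<Sum>i\<in>{1..k}. c i $ v)" for v
  proof -
    have "(\<Sum>i\<in>{1..k}. c i $ v) = (\<Sum>i\<in>{1..k} - D v. c i $ v)"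
      using sum_two_diff[OF pq, of "\<lambda>i. c i $ v"] by (auto simp: D_def)
    also have "\<dots> \<le> (\<Sum>i\<in>{1..k} - D v. if c i $ v = 1 then 1 else 0)"
      using c by (intro sum_mono) (smt (verit) DiffD1)
    also have "\<dots> = int (card {i\<in>{1..k} - D v. c i $ v = 1})"
      by (subst sum.inter_filter[symmetric]) auto
    finally have "nat (\<Sum>i\<in>{1..k}. c i $ v) \<le> card {i\<in>{1..k} - D v. c i $ v = 1}"
      by linarith
    then obtain K where "K \<subseteq> {i\<in>{1..k} - D v. c i $ v = 1}" "card K = nat (\<Sum>i\<in>{1..k}. c i $ v)"
      by (rule obtain_subset_with_card_n)
    \<comment> \<open>Nonnegativity of the total ensures that \<open>nat\<close> has not truncated
      it.\<close>
    then show ?thesis using nonneg[of v] by (intro exI[of _ K]) simp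
  qed
  then obtain K where K: "\<And>v. K v \<subseteq> {i\<in>{1..k} - D v. c i $ v = 1}"
    "\<And>v. int (card (K v)) = (\<Sum>i\<in>{1..k}. c i $ v)" by metis
  define M where "M = (\<lambda>i\<in>{1..k}. (\<chi> v. if i \<in> K v then 1 else (0::int)))"
  have M: "M i $ v = (if i \<in> K v then 1 else 0)" if "i \<in> {1..k}" for i v
    using that by (simp add: M_def)
  have "(\<Sum>i\<in>{1..k}. M i $ v) = (\<Sum>i\<in>{1..k}. c i $ v)" for v
  proof -
    have "{i\<in>{1..k}. i \<in> K v} = K v" using K(1)[of v] by blast
    then have "(\<Sum>i\<in>{1..k}. if i \<in> K v then 1 else (0::int)) = int (card (K v))"
      by (subst sum.inter_filter[symmetric]) auto
    then show ?thesis using K(2)[of v] by (simp add: M)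
  qed
  then have "sum M {1..k} = sum c {1..k}" by (simp add: vec_eq_iff sum_component)
  moreover have "M i $ v = 0 \<or> M i $ v = 1 \<and> c i $ v = 1" if "i \<in> {1..k}" for i v
    using K(1)[of v] by (auto simp: M[OF that])
  ultimately have "reduction k c M"
    by (simp add: reduction_def M_def)
  moreover have "M p $ v = 0 \<and> M q $ v = 0" if "c p $ v + c q $ v = 0" for v
    using K(1)[of v] that pq by (auto simp: M D_def)
  ultimately show ?thesis by (rule that)
qed

text \<open>With \<open>M\<close> avoiding cancelled positions, the new reduction is built vertex by
  vertex from the common value of \<open>c p + c q\<close> and \<open>c' p + c' q\<close>. For 2
  both entries are 1 before and after, so \<open>M\<close> is kept. For 1 exactly one entry is 1 on
  either side, and what \<open>M\<close> has there is carried to the new place. For values at most 0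
  the entries of \<open>M\<close> at \<open>p\<close> and \<open>q\<close> vanish.\<close>

lemma reductions_of_move:
  fixes c :: "nat \<Rightarrow> int ^ 'n::finite"
  assumes move: "(c, c') \<in> tuple_moves (signed_stable_vecs E) k"
    and nonneg: "\<And>v. 0 \<le> (\<Sum>i\<in>{1..k}. c i $ v)"
  obtains M M' where "reduction k c M" "reduction k c' M'"
    "(M, M') \<in> tuple_moves (stable_vecs E) k"
  using move
proof (rule tuple_movesE)
  fix p q
  assume c: "c \<in> {1..k} \<rightarrow>\<^sub>E signed_stable_vecs E" and c': "c' \<in> {1..k} \<rightarrow>\<^sub>E signed_stable_vecs E"
    and pq: "p \<in> {1..k}" "q \<in> {1..k}" "p \<noteq> q" and sum: "c p + c q = c' p + c' q"
    and eq: "\<And>i. i \<noteq> p \<Longrightarrow> i \<noteq> q \<Longrightarrow> c i = c' i"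
  have range: "c i $ v \<in> {-1, 0, 1}" "c' i $ v \<in> {-1, 0, 1}" if "i \<in> {1..k}" for i v
    using c c' that unfolding signed_stable_vecs_def by blast+
  have "c i $ v \<le> 1" if "i \<in> {1..k}" for i v using range(1)[OF that, of v] by auto
  from reduction_avoiding_cancelled[OF nonneg this pq] obtain M where M: "reduction k c M"
    and avoid: "\<And>v. c p $ v + c q $ v = 0 \<Longrightarrow> M p $ v = 0 \<and> M q $ v = 0" by blast
  have M01: "M i $ v = 0 \<or> M i $ v = 1 \<and> c i $ v = 1" if "i \<in> {1..k}" for i v
    using M that unfolding reduction_def by blast
  define f where "f d = (\<chi> v. if c p $ v + c q $ v = 2 then M d $ v
      else if c' d $ v = 1 then M p $ v + M q $ v else 0)" for d
  define M' where "M' = M(p := f p, q := f q)"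
  have sum_v: "c p $ v + c q $ v = c' p $ v + c' q $ v" for v
    using sum by (metis vector_add_component)
  have f01: "f p $ v = 0 \<or> f p $ v = 1 \<and> c' p $ v = 1" "f q $ v = 0 \<or> f q $ v = 1 \<and> c' q $ v = 1"
    "f p $ v + f q $ v = M p $ v + M q $ v" for v
    using range[OF pq(1), of v] range[OF pq(2), of v] M01[OF pq(1), of v] M01[OF pq(2), of v]
      avoid[of v] sum_v[of v]
    by (simp_all only: f_def vec_lambda_beta insert_iff empty_iff) (smt (verit))+
  have M'sum: "M p + M q = M' p + M' q"
    using pq(3) f01(3) by (simp add: M'_def vec_eq_iff)
  have "sum M' ({1..k} - {p, q}) = sum M ({1..k} - {p, q})"
    by (rule sum.cong) (auto simp: M'_def)
  moreover have "sum c' ({1..k} - {p, q}) = sum c ({1..k} - {p, q})"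
    by (rule sum.cong) (auto simp: eq)
  ultimately have "sum M' {1..k} = sum c' {1..k}"
    using M sum M'sum unfolding reduction_def sum_two_diff[OF pq] by metis
  moreover have "M' \<in> {1..k} \<rightarrow>\<^sub>E UNIV"
    using M pq by (auto simp: M'_def reduction_def PiE_def extensional_def)
  moreover have "M' i $ v = 0 \<or> M' i $ v = 1 \<and> c' i $ v = 1" if "i \<in> {1..k}" for i v
    using f01(1,2)[of v] M01[OF that, of v] eq[of i] by (auto simp: M'_def)
  ultimately have M': "reduction k c' M'"
    unfolding reduction_def by blast
  have "(M, M') \<in> tuple_moves (stable_vecs E) k"
    using reduction_tuple[OF c M] reduction_tuple[OF c' M'] pq M'sum
    by (rule tuple_movesI) (auto simp: M'_def)
  with M M' show ?thesis by (rule that)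
qed

lemma stable_vecs_subset: "stable_vecs E \<subseteq> signed_stable_vecs E"
  by (auto simp: stable_vecs_def signed_stable_vecs_def)

lemma reduction_self:
  "x \<in> {1..k} \<rightarrow>\<^sub>E stable_vecs E \<Longrightarrow> reduction k x x"
  by (auto simp: reduction_def stable_vecs_def PiE_def Pi_def)

text \<open>The reduction \<open>P\<close> from which a move can be followed is in general not the
  one just reached. The induction therefore ranges over all reductions \<open>N\<close> of the
  current tuple, and \<open>reductions_connected\<close> closes the gap after each move.\<close>

lemma connected_reductions:
  fixes c :: "nat \<Rightarrow> int ^ 'n::finite"
  assumes "(c, d) \<in> (tuple_moves (signed_stable_vecs E) k)\<^sup>*"
    and c: "c \<in> {1..k} \<rightarrow>\<^sub>E signed_stable_vecs E"
    and nonneg: "\<And>v. 0 \<le> (\<Sum>i\<in>{1..k}. c i $ v)"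
    and M: "reduction k c M"
  shows "reduction k d N \<Longrightarrow> (M, N) \<in> (tuple_moves (stable_vecs E) k)\<^sup>*"
  using assms(1)
proof (induction arbitrary: N rule: rtrancl_induct)
  case base
  then show ?case using reductions_connected[OF c _ M] by blast
next
  case (step d e)
  have d: "d \<in> {1..k} \<rightarrow>\<^sub>E signed_stable_vecs E" "e \<in> {1..k} \<rightarrow>\<^sub>E signed_stable_vecs E"
    using step.hyps(2) by (blast elim: tuple_movesE)+
  have "sum d {1..k} = sum c {1..k}"
    using step.hyps(1) by (induction rule: rtrancl_induct) (auto dest: tuple_moves_sum)
  then have "0 \<le> (\<Sum>i\<in>{1..k}. d i $ v)" for v
    using nonneg[of v] by (simp flip: sum_component)
  from reductions_of_move[OF step.hyps(2) this] obtain P P' where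
    P: "reduction k d P" "reduction k e P'" "(P, P') \<in> tuple_moves (stable_vecs E) k" .
  have "(M, P) \<in> (tuple_moves (stable_vecs E) k)\<^sup>*" by (rule step.IH[OF P(1)])
  also note P(3)
  also have "(P', N) \<in> (tuple_moves (stable_vecs E) k)\<^sup>*"
    by (rule reductions_connected[OF d(2) step.prems P(2)])
  finally show ?case .
qed

text \<open>A tuple of stable sets is a reduction of itself, so a signed path between two such
  tuples descends to an unsigned one with the same ends.\<close>

lemma quad_connected_stable_if_signed:
  fixes E :: "'n::finite set set"
  assumes "quad_connected (signed_stable_vecs E)"
  shows "quad_connected (stable_vecs E)"
  unfolding quad_connected_def
proof (intro allI ballI impI)
  fix k :: nat and x y :: "nat \<Rightarrow> int ^ 'n"
  assume x: "x \<in> {1..k} \<rightarrow>\<^sub>E stable_vecs E" and y: "y \<in> {1..k} \<rightarrow>\<^sub>E stable_vecs E"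
    and sum: "sum x {1..k} = sum y {1..k}"
  have x': "x \<in> {1..k} \<rightarrow>\<^sub>E signed_stable_vecs E" and y': "y \<in> {1..k} \<rightarrow>\<^sub>E signed_stable_vecs E"
    using x y stable_vecs_subset[of E] by (auto simp: PiE_def Pi_def)
  have "(x, y) \<in> (tuple_moves (signed_stable_vecs E) k)\<^sup>*"
    using assms x' y' sum unfolding quad_connected_def by blast
  moreover have "0 \<le> (\<Sum>i\<in>{1..k}. x i $ v)" for v
  proof (rule sum_nonneg)
    fix i assume "i \<in> {1..k}"
    then have "x i \<in> stable_vecs E" using x by auto
    then have "x i $ v \<in> {0, 1}" unfolding stable_vecs_def by blast
    then show "0 \<le> x i $ v" by auto
  qed
  ultimately show "(x, y) \<in> (tuple_moves (stable_vecs E) k)\<^sup>*"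
    using connected_reductions x' reduction_self[OF x] reduction_self[OF y] by blast
qed

section \<open>Changes of sign and cancellation down to stable sets\<close>

definition flip :: "('n \<Rightarrow> int) \<Rightarrow> int ^ 'n \<Rightarrow> int ^ 'n" where
  "flip s b = (\<chi> v. s v * b $ v)"

lemma flip_signed_stable:
  assumes "\<And>v. s v \<in> {-1, 1}" "b \<in> signed_stable_vecs E"
  shows "flip s b \<in> signed_stable_vecs E"
proof -
  have "s v * b $ v \<in> {-1, 0, 1}" for v
  proof -
    have "b $ v \<in> {-1, 0, 1}" using assms(2) unfolding signed_stable_vecs_def by blast
    then show ?thesis using assms(1)[of v] by auto
  qed
  moreover have "s v \<noteq> 0" for v using assms(1)[of v] by auto
  ultimately show ?thesis
    using assms(2) by (simp add: signed_stable_vecs_def flip_def)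
qed

lemma flip_add: "flip s (a + b) = flip s a + flip s b"
  by (simp add: flip_def vec_eq_iff distrib_left)

lemma flip_sum: "flip s (sum f A) = (\<Sum>i\<in>A. flip s (f i))"
  by (simp add: flip_def vec_eq_iff sum_component sum_distrib_left)

lemma flip_flip: "(\<And>v. s v \<in> {-1, 1}) \<Longrightarrow> flip s (flip s b) = b"
proof -
  assume s: "\<And>v. s v \<in> {-1, 1}"
  have "s v * (s v * b $ v) = b $ v" for v using s[of v] by auto
  then show ?thesis by (simp add: flip_def vec_eq_iff)
qed

lemma flip_moves:
  fixes s :: "'n::finite \<Rightarrow> int"
  assumes s: "\<And>v. s v \<in> {-1, 1}"
    and "(x, y) \<in> (tuple_moves (signed_stable_vecs E) k)\<^sup>*"
  shows "((\<lambda>i\<in>{1..k}. flip s (x i)), (\<lambda>i\<in>{1..k}. flip s (y i))) \<in> (tuple_moves (signed_stable_vecs E) k)\<^sup>*"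
  using assms(2)
proof (induction rule: rtrancl_induct)
  case base
  show ?case by simp
next
  case (step y z)
  from step.hyps(2)
  have "((\<lambda>i\<in>{1..k}. flip s (y i)), (\<lambda>i\<in>{1..k}. flip s (z i))) \<in> tuple_moves (signed_stable_vecs E) k"
  proof (rule tuple_movesE)
    fix p q
    assume "y \<in> {1..k} \<rightarrow>\<^sub>E signed_stable_vecs E" "z \<in> {1..k} \<rightarrow>\<^sub>E signed_stable_vecs E"
      and pq: "p \<in> {1..k}" "q \<in> {1..k}" "p \<noteq> q" "y p + y q = z p + z q"
      and eq: "\<And>i. i \<noteq> p \<Longrightarrow> i \<noteq> q \<Longrightarrow> y i = z i"
    then have "(\<lambda>i\<in>{1..k}. flip s (y i)) \<in> {1..k} \<rightarrow>\<^sub>E signed_stable_vecs E"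
      "(\<lambda>i\<in>{1..k}. flip s (z i)) \<in> {1..k} \<rightarrow>\<^sub>E signed_stable_vecs E"
      using flip_signed_stable[of s _ E, OF s] by auto
    then show ?thesis using pq(1-3)
    proof (rule tuple_movesI)
      show "(\<lambda>i\<in>{1..k}. flip s (y i)) p + (\<lambda>i\<in>{1..k}. flip s (y i)) q =
          (\<lambda>i\<in>{1..k}. flip s (z i)) p + (\<lambda>i\<in>{1..k}. flip s (z i)) q"
        using pq by (simp flip: flip_add)
    qed (simp add: eq restrict_def)
  qed
  with step.IH show ?case by (rule rtrancl_into_rtrancl)
qed

lemma moves_mono: "A \<subseteq> B \<Longrightarrow> (tuple_moves A k)\<^sup>* \<subseteq> (tuple_moves B k)\<^sup>*"
  by (rule rtrancl_mono) (fastforce simp: tuple_moves_def PiE_def Pi_def)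

text \<open>If \<open>v\<close> has coordinate \<open>1\<close> in one entry and \<open>-1\<close> in another, a single move sets both
  coordinates to \<open>0\<close>.\<close>

lemma cancel_to_stable:
  fixes c :: "nat \<Rightarrow> int ^ 'n::finite"
  assumes "c \<in> {1..k} \<rightarrow>\<^sub>E signed_stable_vecs E"
    and "\<And>v. 0 \<le> (\<Sum>i\<in>{1..k}. c i $ v)"
  shows "\<exists>M \<in> {1..k} \<rightarrow>\<^sub>E stable_vecs E. (c, M) \<in> (tuple_moves (signed_stable_vecs E) k)\<^sup>*"
  using assms
proof (induction "card {(i, v). i \<in> {1..k} \<and> c i $ v = -1}" arbitrary: c rule: less_induct)
  case less
  have fin: "finite {(i, v). i \<in> {1..k} \<and> P i (v :: 'n)}" for P
    by (rule finite_subset[of _ "{1..k} \<times> UNIV"]) auto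
  have range: "c i $ v \<in> {-1, 0, 1}" if "i \<in> {1..k}" for i v
    using less.prems(1) that unfolding signed_stable_vecs_def by blast
  show ?case
  proof (cases "\<exists>i\<in>{1..k}. \<exists>v. c i $ v = -1")
    case False
    have "c i \<in> stable_vecs E" if "i \<in> {1..k}" for i
      using less.prems(1) that range[OF that] False
      unfolding signed_stable_vecs_def stable_vecs_def by blast
    then have "c \<in> {1..k} \<rightarrow>\<^sub>E stable_vecs E"
      using less.prems(1) by (auto simp: PiE_def)
    then show ?thesis by blast
  next
    case True
    then obtain q v where q: "q \<in> {1..k}" "c q $ v = -1" by blast
    \<comment> \<open>A negative entry in a column with nonnegative sum must be compensated by a
      positive one.\<close>
    have "\<exists>p\<in>{1..k}. 0 < c p $ v"
    proof (rule ccontr)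
      assume "\<not> ?thesis"
      then have "(\<Sum>i\<in>{1..k}. c i $ v) < (\<Sum>i\<in>{1..k}. 0)"
        using q by (intro sum_strict_mono_ex1) force+
      then show False using less.prems(2)[of v] by simp
    qed
    then obtain p where p: "p \<in> {1..k}" "0 < c p $ v" by blast
    then have p1: "c p $ v = 1" using range[of p v] by auto
    have pq: "p \<noteq> q" using p q by auto
    define d where "d = c(p := c p - axis v 1, q := c q + axis v 1)"
    have d_nth: "d i $ u = (if (i = p \<or> i = q) \<and> u = v then 0 else c i $ u)" for i u
      using p1 q(2) pq by (auto simp: d_def axis_def)
    have d_stable: "d i \<in> signed_stable_vecs E" if "i \<in> {1..k}" for i
    proof -
      have "{u. d i $ u \<noteq> 0} \<subseteq> {u. c i $ u \<noteq> 0}" by (auto simp: d_nth)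
      moreover have "stable_set UNIV E {u. c i $ u \<noteq> 0}"
        using less.prems(1) that unfolding signed_stable_vecs_def by blast
      ultimately have "stable_set UNIV E {u. d i $ u \<noteq> 0}"
        using stable_set_subset by blast
      moreover have "d i $ u \<in> {-1, 0, 1}" for u
        using range[OF that, of u] by (auto simp: d_nth)
      ultimately show ?thesis unfolding signed_stable_vecs_def by blast
    qed
    moreover have "d i = undefined" if "i \<notin> {1..k}" for i
      using that p(1) q(1) less.prems(1) by (auto simp: d_def PiE_def extensional_def)
    ultimately have d: "d \<in> {1..k} \<rightarrow>\<^sub>E signed_stable_vecs E" by (intro PiE_I)
    have move: "(c, d) \<in> tuple_moves (signed_stable_vecs E) k"
      using less.prems(1) d p(1) q(1) pq
      by (rule tuple_movesI) (use pq in \<open>auto simp: d_def\<close>)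
    have nonneg: "0 \<le> (\<Sum>i\<in>{1..k}. d i $ u)" for u
      using less.prems(2)[of u] tuple_moves_sum[OF move] by (simp flip: sum_component)
    have "c i $ u = -1" if "d i $ u = -1" for i u
      using that by (auto simp: d_nth split: if_splits)
    moreover have "d q $ v \<noteq> -1" by (simp add: d_nth)
    ultimately have "{(i, u). i \<in> {1..k} \<and> d i $ u = -1} \<subset> {(i, u). i \<in> {1..k} \<and> c i $ u = -1}"
      using q by blast
    then have "card {(i, u). i \<in> {1..k} \<and> d i $ u = -1} < card {(i, u). i \<in> {1..k} \<and> c i $ u = -1}"
      by (intro psubset_card_mono fin)
    then obtain M where "M \<in> {1..k} \<rightarrow>\<^sub>E stable_vecs E" "(d, M) \<in> (tuple_moves (signed_stable_vecs E) k)\<^sup>*"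
      using less.hyps[OF _ d nonneg] by blast
    then show ?thesis using move by (meson converse_rtrancl_into_rtrancl)
  qed
qed

lemma quad_connected_signed_if_stable:
  fixes E :: "'n::finite set set"
  assumes conn: "quad_connected (stable_vecs E)"
  shows "quad_connected (signed_stable_vecs E)"
  unfolding quad_connected_def
proof (intro allI ballI impI)
  fix k :: nat and x y :: "nat \<Rightarrow> int ^ 'n"
  assume x: "x \<in> {1..k} \<rightarrow>\<^sub>E signed_stable_vecs E" and y: "y \<in> {1..k} \<rightarrow>\<^sub>E signed_stable_vecs E"
    and sum: "sum x {1..k} = sum y {1..k}"
  let ?T = "(tuple_moves (signed_stable_vecs E) k)\<^sup>*"
  have nonneg_case: "(c, d) \<in> ?T"
    if c: "c \<in> {1..k} \<rightarrow>\<^sub>E signed_stable_vecs E" and d: "d \<in> {1..k} \<rightarrow>\<^sub>E signed_stable_vecs E"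
      and sum: "sum c {1..k} = sum d {1..k}" and nonneg: "\<And>v. 0 \<le> sum c {1..k} $ v" for c d
  proof -
    obtain M where M: "M \<in> {1..k} \<rightarrow>\<^sub>E stable_vecs E" "(c, M) \<in> ?T"
      using cancel_to_stable[OF c] nonneg by (auto simp: sum_component)
    obtain N where N: "N \<in> {1..k} \<rightarrow>\<^sub>E stable_vecs E" "(d, N) \<in> ?T"
      using cancel_to_stable[OF d] nonneg unfolding sum by (auto simp: sum_component)
    have "sum a {1..k} = sum b {1..k}" if "(a, b) \<in> ?T" for a b
      using that by (induction rule: rtrancl_induct) (auto dest: tuple_moves_sum)
    then have "sum M {1..k} = sum N {1..k}" using M(2) N(2) sum by metis
    then have "(M, N) \<in> (tuple_moves (stable_vecs E) k)\<^sup>*"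
      using conn M(1) N(1) unfolding quad_connected_def by blast
    then have "(M, N) \<in> ?T" using moves_mono[OF stable_vecs_subset] by blast
    then show ?thesis
      using M(2) tuple_moves_rtrancl_sym[OF N(2)] by (meson rtrancl_trans)
  qed
  \<comment> \<open>The signs come from the common sum of \<open>x\<close> and \<open>y\<close>, so
    one flip makes both totals nonnegative. Being an involution that maps moves to moves, it also
    carries the resulting path back.\<close>
  define s where "s v = (if 0 \<le> sum x {1..k} $ v then 1 else (-1::int))" for v
  have s: "s v \<in> {-1, 1}" for v by (simp add: s_def)
  define fl where "fl z = (\<lambda>i\<in>{1..k}. flip s (z i))" for z :: "nat \<Rightarrow> int ^ 'n"
  have fl_sum: "sum (fl z) {1..k} = flip s (sum z {1..k})" for z
    by (simp add: fl_def flip_sum)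
  have fl_fl: "fl (fl z) = z" if "z \<in> {1..k} \<rightarrow>\<^sub>E signed_stable_vecs E" for z
    using that flip_flip[OF s] by (auto simp: fl_def fun_eq_iff PiE_def extensional_def)
  have "(fl x, fl y) \<in> ?T"
  proof (rule nonneg_case)
    show "fl x \<in> {1..k} \<rightarrow>\<^sub>E signed_stable_vecs E" "fl y \<in> {1..k} \<rightarrow>\<^sub>E signed_stable_vecs E"
      using x y flip_signed_stable[of s _ E, OF s] by (auto simp: fl_def)
    show "sum (fl x) {1..k} = sum (fl y) {1..k}" by (simp only: fl_sum sum)
    show "0 \<le> sum (fl x) {1..k} $ v" for v
      unfolding fl_sum by (auto simp: flip_def s_def)
  qed
  then have "(fl (fl x), fl (fl y)) \<in> ?T"
    unfolding fl_def by (rule flip_moves[OF s])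
  then show "(x, y) \<in> ?T" using fl_fl[OF x] fl_fl[OF y] by simp
qed

section \<open>Kempe switchings and moves\<close>

text \<open>These are the facts about components on which the properness of a switched coloring
  rests: no edge inside \<open>W\<close> leaves \<open>C\<close>.\<close>

lemma graph_component_closed:
  assumes "C \<in> graph_components W (induced_edges E W)"
  shows "C \<subseteq> W" "\<And>u v. u \<in> C \<Longrightarrow> v \<in> W \<Longrightarrow> {u, v} \<in> E \<Longrightarrow> v \<in> C"
proof -
  let ?R = "{(u, v). u \<in> W \<and> v \<in> W \<and> {u, v} \<in> induced_edges E W}"
  from assms obtain w where w: "w \<in> W" "C = ?R\<^sup>* `` {w}"
    unfolding graph_components_def by (rule quotientE)
  have "v \<in> W" if "(w, v) \<in> ?R\<^sup>*" for v
    using that by (induction rule: rtrancl_induct) (use w(1) in auto)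
  then show sub: "C \<subseteq> W" using w(2) by blast
  show "v \<in> C" if "u \<in> C" "v \<in> W" "{u, v} \<in> E" for u v
  proof -
    have "(u, v) \<in> ?R" using that sub by (auto simp: induced_edges_def)
    then show ?thesis using that(1) w(2) by (auto intro: rtrancl_into_rtrancl)
  qed
qed

lemma coloringsD:
  assumes "f \<in> colorings V E k"
  shows "f \<in> V \<rightarrow>\<^sub>E {1..k}" "u \<in> V \<Longrightarrow> v \<in> V \<Longrightarrow> {u, v} \<in> E \<Longrightarrow> f u \<noteq> f v"
  using assms by (auto simp: colorings_def)

text \<open>A two-color change without reference to components: any number of components of the
  subgraph in colors \<open>i\<close> and \<open>j\<close> may be affected at once.\<close>

definition recolors :: "'v set \<Rightarrow> nat \<Rightarrow> nat \<Rightarrow> ('v \<Rightarrow> nat) \<Rightarrow> ('v \<Rightarrow> nat) \<Rightarrow> bool" where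
  "recolors V i j f g \<longleftrightarrow> (\<forall>x\<in>V. if f x \<in> {i, j} then g x \<in> {i, j} else g x = f x)"

lemma recolors_iff: "recolors V i j f g \<Longrightarrow> x \<in> V \<Longrightarrow> g x \<in> {i, j} \<longleftrightarrow> f x \<in> {i, j}"
  unfolding recolors_def by metis

lemma recolors_other: "recolors V i j f g \<Longrightarrow> x \<in> V \<Longrightarrow> l \<notin> {i, j} \<Longrightarrow> g x = l \<longleftrightarrow> f x = l"
  unfolding recolors_def by metis

lemma kempe_switchingD:
  assumes "(f, g) \<in> kempe_switching V E k"
  shows "f \<in> colorings V E k" "g \<in> colorings V E k"
    "\<exists>i\<in>{1..k}. \<exists>j\<in>{1..k}. i \<noteq> j \<and> recolors V i j f g"
proof -
  from assms obtain i j C where f: "f \<in> colorings V E k" and ij: "1 \<le> i" "i < j" "j \<le> k"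
    and C: "C \<in> graph_components {v \<in> V. f v = i \<or> f v = j} (induced_edges E {v \<in> V. f v = i \<or> f v = j})"
    and g: "g = (\<lambda>v. if v \<in> C then Transposition.transpose i j (f v) else f v)"
    unfolding kempe_switching_def Let_def by blast
  show "f \<in> colorings V E k" by (rule f)
  note C' = graph_component_closed[OF C]
  have gC: "f v \<in> {i, j}" "g v \<in> {i, j}" if "v \<in> C" for v
    using C'(1) that by (auto simp: g)
  have "recolors V i j f g"
    using gC by (auto simp: recolors_def g)
  then show "\<exists>i\<in>{1..k}. \<exists>j\<in>{1..k}. i \<noteq> j \<and> recolors V i j f g"
    using ij by (intro bexI[of _ i] bexI[of _ j]) auto
  have "g v \<in> {1..k}" if "v \<in> V" for v
  proof (cases "v \<in> C")
    case True
    then show ?thesis using gC(2)[OF True] ij by auto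
  next
    case False
    then show ?thesis using coloringsD(1)[OF f] that by (auto simp: g)
  qed
  moreover have "g v = undefined" if "v \<notin> V" for v
    using C'(1) that coloringsD(1)[OF f] by (auto simp: g PiE_def extensional_def)
  moreover have "g u \<noteq> g v" if uv: "u \<in> V" "v \<in> V" "{u, v} \<in> E" for u v
  proof -
    have fne: "f u \<noteq> f v" using coloringsD(2)[OF f uv] .
    \<comment> \<open>A neighbor of \<open>C\<close> outside \<open>C\<close> has neither color
      \<open>i\<close> nor color \<open>j\<close>, for otherwise it would belong to the
      component.\<close>
    have mixed: "g x \<noteq> g y" if "x \<in> C" "y \<notin> C" "y \<in> V" "{x, y} \<in> E" for x y
    proof -
      have "f y \<notin> {i, j}" using C'(2)[of x y] that by blast
      then show ?thesis using gC(2)[OF that(1)] that(2) by (auto simp: g)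
    qed
    consider "u \<in> C" "v \<in> C" | "u \<notin> C" "v \<notin> C" | "u \<in> C" "v \<notin> C" | "u \<notin> C" "v \<in> C"
      by blast
    then show ?thesis
    proof cases
      case 1
      then show ?thesis using fne by (simp add: g inj_eq[OF inj_transpose])
    next
      case 2
      then show ?thesis using fne by (simp add: g)
    next
      case 3
      then show ?thesis using mixed uv by blast
    next
      case 4
      then show ?thesis using mixed[of v u] uv by (metis insert_commute)
    qed
  qed
  ultimately show "g \<in> colorings V E k"
    unfolding colorings_def by auto
qed

text \<open>On a component of the subgraph of colors \<open>i\<close> and \<open>j\<close> the two colorings either agree
  everywhere or differ everywhere, so switching the components of the second kind turns one
  coloring into the other.\<close>

lemma recolors_kempe_equivalent:
  assumes V: "finite V" and ij: "i \<in> {1..k}" "j \<in> {1..k}" "i < j" and g: "g \<in> colorings V E k"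
  shows "f \<in> colorings V E k \<Longrightarrow> recolors V i j f g \<Longrightarrow> kempe_equivalent V E k f g"
proof (induction "card {v\<in>V. f v \<noteq> g v}" arbitrary: f rule: less_induct)
  case less
  note f = less.prems(1) and rec = less.prems(2)
  show ?case
  proof (cases "\<exists>v\<in>V. f v \<noteq> g v")
    case False
    then have "f = g"
      using coloringsD(1)[OF f] coloringsD(1)[OF g] by (intro PiE_ext) auto
    then show ?thesis by (simp add: kempe_equivalent_def)
  next
    case True
    then obtain w where w: "w \<in> V" "f w \<noteq> g w" by blast
    define W where "W = {v \<in> V. f v = i \<or> f v = j}"
    let ?R = "{(u, v). u \<in> W \<and> v \<in> W \<and> {u, v} \<in> induced_edges E W}"
    define C where "C = ?R\<^sup>* `` {w}"
    define h where "h = (\<lambda>v. if v \<in> C then Transposition.transpose i j (f v) else f v)"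
    have wW: "w \<in> W" using w rec by (auto simp: W_def recolors_def split: if_splits)
    have comp: "C \<in> graph_components W (induced_edges E W)"
      unfolding C_def graph_components_def using wW by (rule quotientI)
    have CW: "C \<subseteq> W" by (rule graph_component_closed(1)[OF comp])
    have switch: "(f, h) \<in> kempe_switching V E k"
      unfolding kempe_switching_def Let_def
      using f ij comp unfolding W_def h_def by auto
    have gW: "g v \<in> {i, j}" if "v \<in> W" for v
      using that rec by (auto simp: W_def recolors_def)
    \<comment> \<open>Adjacent vertices of \<open>W\<close> carry both colors under \<open>f\<close>
      and under \<open>g\<close>, so a disagreement at one end forces one at the other.\<close>
    have differ: "f v \<noteq> g v" if "(w, v) \<in> ?R\<^sup>*" for v
      using that
    proof (induction rule: rtrancl_induct)
      case base
      show ?case by (rule w(2))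
    next
      case (step u v)
      then have uv: "u \<in> W" "v \<in> W" "{u, v} \<in> E" by (auto simp: induced_edges_def)
      then have "f u \<noteq> f v" "g u \<noteq> g v"
        using coloringsD(2)[OF f] coloringsD(2)[OF g] by (auto simp: W_def)
      then show ?case using step.IH gW[OF uv(1)] gW[OF uv(2)] uv(1,2) by (auto simp: W_def)
    qed
    have hC: "h v = g v" if "v \<in> C" for v
    proof -
      have "f v \<noteq> g v" using that differ by (auto simp: C_def)
      moreover have "f v \<in> {i, j}" using that CW by (auto simp: W_def)
      ultimately show ?thesis using that gW[of v] CW ij(3) by (auto simp: h_def)
    qed
    have rec': "recolors V i j h g"
      unfolding recolors_def
    proof
      fix v assume v: "v \<in> V"
      show "if h v \<in> {i, j} then g v \<in> {i, j} else g v = h v"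
      proof (cases "v \<in> C")
        case True
        then show ?thesis using hC by simp
      next
        case False
        then have "h v = f v" by (simp add: h_def)
        then show ?thesis using rec v unfolding recolors_def by metis
      qed
    qed
    have "{v\<in>V. h v \<noteq> g v} \<subset> {v\<in>V. f v \<noteq> g v}"
    proof
      show "{v\<in>V. h v \<noteq> g v} \<subseteq> {v\<in>V. f v \<noteq> g v}"
        using hC by (auto simp: h_def)
      have "w \<in> C" by (simp add: C_def)
      then show "{v\<in>V. h v \<noteq> g v} \<noteq> {v\<in>V. f v \<noteq> g v}"
        using w hC by blast
    qed
    then have "card {v\<in>V. h v \<noteq> g v} < card {v\<in>V. f v \<noteq> g v}"
      using V by (intro psubset_card_mono) auto
    then have "kempe_equivalent V E k h g"
      using less.hyps kempe_switchingD(2)[OF switch] rec' by blast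
    then show ?thesis
      using switch unfolding kempe_equivalent_def by (rule converse_rtrancl_into_rtrancl[rotated])
  qed
qed

corollary recolors_kempe_equivalent':
  assumes "finite V" "i \<in> {1..k}" "j \<in> {1..k}" "i \<noteq> j"
    "f \<in> colorings V E k" "g \<in> colorings V E k" "recolors V i j f g"
  shows "kempe_equivalent V E k f g"
proof (cases "i < j")
  case True
  then show ?thesis using assms recolors_kempe_equivalent by blast
next
  case False
  have "recolors V j i f g" using assms(7) unfolding recolors_def insert_commute[of j i "{}"] .
  then show ?thesis using assms False recolors_kempe_equivalent[of V j k i] by simp
qed

lemma kempe_equivalent_trans:
  "kempe_equivalent V E k f g \<Longrightarrow> kempe_equivalent V E k g h \<Longrightarrow> kempe_equivalent V E k f h"
  unfolding kempe_equivalent_def by (rule rtrancl_trans)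

section \<open>Colorings of blow-ups as tuples of stable sets\<close>

locale blowup =
  fixes E :: "'n::finite set set" and a :: "'n \<Rightarrow> nat" and k :: nat
  assumes simple: "simple_graph UNIV E"
begin

abbreviation "verts \<equiv> blowup_verts UNIV a"
abbreviation "cols \<equiv> colorings verts (blowup_edges UNIV E a) k"
abbreviation "kempe \<equiv> kempe_equivalent verts (blowup_edges UNIV E a) k"

text \<open>Counting copies, instead of testing whether one has color \<open>i\<close>, makes sums
  over colors plain counts of copies. For proper colorings the entries are 0 or 1.\<close>

definition class_vecs :: "('n \<times> nat \<Rightarrow> nat) \<Rightarrow> nat \<Rightarrow> int ^ 'n" where
  "class_vecs f = (\<lambda>i\<in>{1..k}. \<chi> v. int (card {p. p < a v \<and> f (v, p) = i}))"

lemma in_verts [simp]: "(v, p) \<in> verts \<longleftrightarrow> p < a v"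
  by (simp add: blowup_verts_def)

lemma finite_verts: "finite verts"
  by (simp add: blowup_verts_def)

lemma edge_iff:
  "p < a v \<Longrightarrow> q < a u \<Longrightarrow>
    {(v, p), (u, q)} \<in> blowup_edges UNIV E a \<longleftrightarrow> v = u \<and> p \<noteq> q \<or> {v, u} \<in> E"
  by (auto simp: blowup_edges_def doubleton_eq_iff insert_commute)

lemma cols_iff:
  "f \<in> cols \<longleftrightarrow> f \<in> verts \<rightarrow>\<^sub>E {1..k} \<and>
    (\<forall>v p u q. p < a v \<longrightarrow> q < a u \<longrightarrow> v = u \<and> p \<noteq> q \<or> {v, u} \<in> E \<longrightarrow> f (v, p) \<noteq> f (u, q))"
  unfolding colorings_def using edge_iff by (auto simp: split_paired_all)

lemma cols_range: "f \<in> cols \<Longrightarrow> p < a v \<Longrightarrow> f (v, p) \<in> {1..k}"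
  unfolding cols_iff using in_verts by blast

lemma cols_proper:
  "f \<in> cols \<Longrightarrow> p < a v \<Longrightarrow> q < a u \<Longrightarrow> v = u \<and> p \<noteq> q \<or> {v, u} \<in> E \<Longrightarrow> f (v, p) \<noteq> f (u, q)"
  unfolding cols_iff by blast

lemma class_vecs_nth: "i \<in> {1..k} \<Longrightarrow> class_vecs f i $ v = int (card {p. p < a v \<and> f (v, p) = i})"
  by (simp add: class_vecs_def)

text \<open>The copies of a vertex are pairwise adjacent, so at most one of them has a given
  color.\<close>

lemma class_vecs_of_bool:
  assumes f: "f \<in> cols" and i: "i \<in> {1..k}"
  shows "class_vecs f i $ v = of_bool (\<exists>p<a v. f (v, p) = i)"
proof (cases "\<exists>p<a v. f (v, p) = i")
  case True
  then obtain p where p: "p < a v" "f (v, p) = i" by blast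
  have "{q. q < a v \<and> f (v, q) = i} = {p}"
    using p cols_proper[OF f] by blast
  then show ?thesis using True by (simp add: class_vecs_nth[OF i])
next
  case False
  then have "{q. q < a v \<and> f (v, q) = i} = {}" by blast
  then show ?thesis using False by (auto simp: class_vecs_nth[OF i])
qed

lemma class_vecs_tuple:
  assumes f: "f \<in> cols"
  shows "class_vecs f \<in> {1..k} \<rightarrow>\<^sub>E stable_vecs E"
proof (rule PiE_I)
  fix i assume i: "i \<in> {1..k}"
  note nth = class_vecs_of_bool[OF f i]
  have "\<not> e \<subseteq> {v. class_vecs f i $ v \<noteq> 0}" if e: "e \<in> E" for e
  proof
    assume sub: "e \<subseteq> {v. class_vecs f i $ v \<noteq> 0}"
    from simple e have "card e = 2" by (auto simp: simple_graph_def)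
    then obtain u v where uv: "e = {u, v}" by (meson card_2_iff)
    with sub obtain p q where "p < a u" "f (u, p) = i" "q < a v" "f (v, q) = i"
      by (auto simp: nth)
    then show False using cols_proper[OF f, of p u q v] e uv by simp
  qed
  then show "class_vecs f i \<in> stable_vecs E"
    by (auto simp: stable_vecs_def stable_set_def nth)
qed (auto simp: class_vecs_def)

lemma class_vecs_sum:
  assumes f: "f \<in> cols"
  shows "(\<Sum>i\<in>{1..k}. class_vecs f i $ v) = int (a v)"
proof -
  have "(\<Sum>i\<in>{1..k}. card {p\<in>{..<a v}. f (v, p) = i}) = card {..<a v}"
    unfolding card_eq_sum by (rule sum.group) (use cols_range[OF f] in auto)
  then show ?thesis
    by (simp add: class_vecs_nth flip: of_nat_sum)
qed

lemma class_vecs_add: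
  assumes "i \<in> {1..k}" "j \<in> {1..k}" "i \<noteq> j"
  shows "class_vecs f i $ v + class_vecs f j $ v = int (card {p. p < a v \<and> f (v, p) \<in> {i, j}})"
proof -
  have "{p. p < a v \<and> f (v, p) \<in> {i, j}} = {p. p < a v \<and> f (v, p) = i} \<union> {p. p < a v \<and> f (v, p) = j}"
    by blast
  then show ?thesis
    using assms by (simp add: class_vecs_nth card_Un_disjoint disjoint_iff)
qed

text \<open>At every vertex the set of copies colored \<open>i\<close> or \<open>j\<close> is
  unchanged, which fixes the sum of the two class vectors; the other color classes stay the
  same.\<close>

lemma recolors_move:
  assumes f: "f \<in> cols" and g: "g \<in> cols" and ij: "i \<in> {1..k}" "j \<in> {1..k}" "i \<noteq> j"
    and rec: "recolors verts i j f g"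
  shows "(class_vecs f, class_vecs g) \<in> tuple_moves (stable_vecs E) k"
  using class_vecs_tuple[OF f] class_vecs_tuple[OF g] ij
proof (rule tuple_movesI)
  have "{p. p < a v \<and> g (v, p) \<in> {i, j}} = {p. p < a v \<and> f (v, p) \<in> {i, j}}" for v
    using recolors_iff[OF rec] in_verts by blast
  then show "class_vecs f i + class_vecs f j = class_vecs g i + class_vecs g j"
    by (simp only: vec_eq_iff vector_add_component class_vecs_add[OF ij]) simp
  fix l assume "l \<noteq> i" "l \<noteq> j"
  then have "{p. p < a v \<and> g (v, p) = l} = {p. p < a v \<and> f (v, p) = l}" for v
    using recolors_other[OF rec, of _ l] in_verts by blast
  then show "class_vecs f l = class_vecs g l"
    by (simp add: class_vecs_def restrict_def)
qed

lemma kempe_moves: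
  assumes "kempe f g"
  shows "(class_vecs f, class_vecs g) \<in> (tuple_moves (stable_vecs E) k)\<^sup>*"
  using assms unfolding kempe_equivalent_def
proof (induction rule: rtrancl_induct)
  case base
  show ?case by simp
next
  case (step g h)
  from kempe_switchingD[OF step.hyps(2)] recolors_move
  have "(class_vecs g, class_vecs h) \<in> tuple_moves (stable_vecs E) k" by blast
  with step.IH show ?case by (rule rtrancl_into_rtrancl)
qed

text \<open>The indices of the stable sets containing \<open>v\<close> number \<open>a v\<close>,
  and any bijection from the copies of \<open>v\<close> to them is a choice of colors. Injectivity
  separates the copies of one vertex, stability separates adjacent vertices.\<close>

lemma ex_coloring:
  assumes x: "x \<in> {1..k} \<rightarrow>\<^sub>E stable_vecs E" and sum: "\<And>v. (\<Sum>i\<in>{1..k}. x i $ v) = int (a v)"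
  obtains f where "f \<in> cols" "class_vecs f = x"
proof -
  define K where "K v = {i\<in>{1..k}. x i $ v = 1}" for v
  have x01: "x i $ v \<in> {0, 1}" and stable: "stable_set UNIV E {v. x i $ v \<noteq> 0}" if "i \<in> {1..k}" for i v
    using x that unfolding stable_vecs_def by blast+
  have "card (K v) = a v" for v
  proof -
    have "(\<Sum>i\<in>{1..k}. x i $ v) = (\<Sum>i\<in>{1..k}. if x i $ v = 1 then 1 else 0)"
      using x01 by (intro sum.cong) auto
    also have "\<dots> = int (card (K v))"
      unfolding K_def by (subst sum.inter_filter[symmetric]) auto
    finally show ?thesis using sum[of v] by simp
  qed
  then have "\<exists>h. bij_betw h {..<a v} (K v)" for v
    using ex_bij_betw_nat_finite[of "K v"] by (simp add: K_def atLeast0LessThan)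
  then obtain h where h: "\<And>v. bij_betw (h v) {..<a v} (K v)" by metis
  define f where "f = (\<lambda>x\<in>verts. h (fst x) (snd x))"
  have fh: "f (v, p) = h v p" if "p < a v" for v p
    using that by (simp add: f_def)
  have hK: "h v p \<in> K v" if "p < a v" for v p
    using bij_betwE[OF h[of v]] that by simp
  have "f (v, p) \<noteq> f (u, q)" if pq: "p < a v" "q < a u" and adj: "v = u \<and> p \<noteq> q \<or> {v, u} \<in> E" for v p u q
    using adj
  proof
    assume "v = u \<and> p \<noteq> q"
    then show ?thesis
      using bij_betw_imp_inj_on[OF h[of v]] pq by (auto simp: fh inj_on_def)
  next
    assume e: "{v, u} \<in> E"
    show ?thesis
    proof
      assume "f (v, p) = f (u, q)"
      then have "h v p \<in> K v" "h v p \<in> K u" using hK pq by (metis fh)+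
      then show False
        using stable[of "h v p"] e by (auto simp: stable_set_def K_def)
    qed
  qed
  moreover have "f \<in> verts \<rightarrow>\<^sub>E {1..k}"
    using hK by (auto simp: f_def K_def blowup_verts_def)
  ultimately have f: "f \<in> cols" unfolding cols_iff by blast
  have "class_vecs f i $ v = x i $ v" if i: "i \<in> {1..k}" for i v
  proof -
    have "(\<exists>p<a v. f (v, p) = i) \<longleftrightarrow> i \<in> K v"
      unfolding bij_betw_imp_surj_on[OF h[of v], symmetric] by (force simp: fh)
    then show ?thesis
      using x01[OF i, of v] i by (auto simp: class_vecs_of_bool[OF f i] K_def)
  qed
  then have "class_vecs f = x"
    using class_vecs_tuple[OF f] x by (intro PiE_ext) (auto simp: vec_eq_iff)
  with f show ?thesis by (rule that)
qed

text \<open>Let \<open>s v\<close> count the copies of \<open>v\<close> with color \<open>i\<close>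
  or \<open>j\<close>. For \<open>s v = 2\<close> the vertex lies in both classes before and after
  the move and nothing changes; for \<open>s v = 1\<close> its single such copy takes the color
  whose class in \<open>y\<close> contains \<open>v\<close>.\<close>

lemma lift_move:
  assumes f: "f \<in> cols" and move: "(class_vecs f, y) \<in> tuple_moves (stable_vecs E) k"
  obtains g where "g \<in> cols" "kempe f g" "class_vecs g = y"
  using move
proof (rule tuple_movesE)
  fix i j
  assume y: "y \<in> {1..k} \<rightarrow>\<^sub>E stable_vecs E" and ij: "i \<in> {1..k}" "j \<in> {1..k}" "i \<noteq> j"
    and sum: "class_vecs f i + class_vecs f j = y i + y j"
    and other: "\<And>l. l \<noteq> i \<Longrightarrow> l \<noteq> j \<Longrightarrow> class_vecs f l = y l"
  have y01: "y l $ v \<in> {0, 1}" and stable: "stable_set UNIV E {v. y l $ v \<noteq> 0}" if "l \<in> {1..k}" for l v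
    using y that unfolding stable_vecs_def by blast+
  define s where "s v = y i $ v + y j $ v" for v
  have s_sum: "s v = class_vecs f i $ v + class_vecs f j $ v" for v
    using sum unfolding s_def by (metis vector_add_component)
  then have s_card: "s v = int (card {p. p < a v \<and> f (v, p) \<in> {i, j}})" for v
    using class_vecs_add[OF ij] by simp
  have s_range: "s v \<in> {0, 1, 2}" for v
    using y01[OF ij(1), of v] y01[OF ij(2), of v] by (auto simp: s_def)
  have s_pos: "s v \<noteq> 0" if "p < a v" "f (v, p) \<in> {i, j}" for v p
    using that by (auto simp: s_card)
  have s1: "p = q" if "s v = 1" "p < a v" "q < a v" "f (v, p) \<in> {i, j}" "f (v, q) \<in> {i, j}" for v p q
  proof -
    have "card {p. p < a v \<and> f (v, p) \<in> {i, j}} = 1" using that(1) by (simp add: s_card)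
    then obtain r where r: "{p. p < a v \<and> f (v, p) \<in> {i, j}} = {r}" by (rule card_1_singletonE)
    have "p \<in> {r}" "q \<in> {r}"
      using that unfolding r[symmetric] by simp_all
    then show ?thesis by simp
  qed
  have s2: "\<exists>p<a v. f (v, p) = l" if "s v = 2" "l \<in> {i, j}" for v l
    using that by (auto simp: s_sum class_vecs_of_bool[OF f ij(1)] class_vecs_of_bool[OF f ij(2)]
        of_bool_def split: if_splits)
  \<comment> \<open>The default \<open>j\<close> is the right color: \<open>s v = 1\<close> together
    with \<open>y i $ v\<close> different from 1 gives \<open>y j $ v = 1\<close>.\<close>
  define g where "g = (\<lambda>x\<in>verts. if f x \<in> {i, j} \<and> s (fst x) = 1
    then if y i $ fst x = 1 then i else j else f x)"
  have g: "g (v, p) = (if f (v, p) \<in> {i, j} \<and> s v = 1 then if y i $ v = 1 then i else j else f (v, p))"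
    if "p < a v" for v p
    using that by (simp add: g_def)
  \<comment> \<open>In a conflict with a copy of \<open>u\<close> that was not recolored,
    \<open>s u = 2\<close>. Then some copy of \<open>u\<close> has the old color of
    \<open>(v, p)\<close>, so \<open>f\<close> was already improper along the edge.\<close>
  have mixed: "g (v, p) \<noteq> g (u, q)"
    if pq: "p < a v" "q < a u" and adj: "v = u \<and> p \<noteq> q \<or> {v, u} \<in> E"
      and A: "f (v, p) \<in> {i, j}" "s v = 1" and B: "\<not> (f (u, q) \<in> {i, j} \<and> s u = 1)" for v p u q
  proof
    assume eq: "g (v, p) = g (u, q)"
    have "g (v, p) \<in> {i, j}" "g (u, q) = f (u, q)" using A B pq by (auto simp: g)
    then have fu: "f (u, q) \<in> {i, j}" using eq by simp
    then have su: "s u = 2" using s_range[of u] s_pos[OF pq(2)] B by auto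
    then have e: "{v, u} \<in> E" using adj A by auto
    obtain r where "r < a u" "f (u, r) = f (v, p)" using s2[OF su A(1)] by blast
    then show False using cols_proper[OF f pq(1), of r u] e by simp
  qed
  have "g (v, p) \<noteq> g (u, q)"
    if pq: "p < a v" "q < a u" and adj: "v = u \<and> p \<noteq> q \<or> {v, u} \<in> E" for v p u q
  proof -
    let ?A = "f (v, p) \<in> {i, j} \<and> s v = 1" and ?B = "f (u, q) \<in> {i, j} \<and> s u = 1"
    consider "?A" "?B" | "?A" "\<not> ?B" | "\<not> ?A" "?B" | "\<not> ?A" "\<not> ?B" by blast
    then show ?thesis
    proof cases
      case 1
      \<comment> \<open>Two copies of one vertex are excluded, since only one copy is counted by
        \<open>s v = 1\<close>.\<close>
      then have e: "{v, u} \<in> E" using adj s1 pq by blast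
      have gv: "g (v, p) = (if y i $ v = 1 then i else j)" "g (u, q) = (if y i $ u = 1 then i else j)"
        using 1 pq by (auto simp: g)
      have not_both: "\<not> (y l $ v \<noteq> 0 \<and> y l $ u \<noteq> 0)" if "l \<in> {1..k}" for l
        using stable[OF that] e by (auto simp: stable_set_def)
      have "y j $ v \<noteq> 0" if "y i $ v \<noteq> 1" using that 1 y01[OF ij(1), of v] by (auto simp: s_def)
      moreover have "y j $ u \<noteq> 0" if "y i $ u \<noteq> 1" using that 1 y01[OF ij(1), of u] by (auto simp: s_def)
      ultimately show ?thesis
        using not_both[OF ij(1)] not_both[OF ij(2)] ij(3) by (auto simp: gv)
    next
      case 2
      then show ?thesis using mixed pq adj by blast
    next
      case 3
      then show ?thesis using mixed[of q u p v] pq adj by (metis insert_commute)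
    next
      case 4
      then have "g (v, p) = f (v, p)" "g (u, q) = f (u, q)" using pq by (simp_all only: g if_False)
      then show ?thesis using cols_proper[OF f pq adj] by simp
    qed
  qed
  moreover have "g \<in> verts \<rightarrow>\<^sub>E {1..k}"
  proof (rule PiE_I)
    fix x assume "x \<in> verts"
    then show "g x \<in> {1..k}"
      using coloringsD(1)[OF f] ij by (auto simp: g_def)
  qed (simp add: g_def)
  ultimately have gcol: "g \<in> cols" unfolding cols_iff by blast
  have rec: "recolors verts i j f g"
    by (auto simp: recolors_def g_def)
  have kempe: "kempe f g"
    by (rule recolors_kempe_equivalent'[OF finite_verts ij f gcol rec])
  have "class_vecs g l $ v = y l $ v" if l: "l \<in> {1..k}" for l v
  proof (cases "l \<in> {i, j}")
    case False
    then have "{p. p < a v \<and> g (v, p) = l} = {p. p < a v \<and> f (v, p) = l}"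
      using recolors_other[OF rec] in_verts by blast
    then have "class_vecs g l $ v = class_vecs f l $ v" by (simp add: class_vecs_nth[OF l])
    then show ?thesis using other[of l] False by simp
  next
    case True
    show ?thesis
    proof (cases "s v = 1")
      case s: True
      have "card {p. p < a v \<and> f (v, p) \<in> {i, j}} = 1" using s by (simp add: s_card)
      moreover have "{p. p < a v \<and> g (v, p) = l} = (if y l $ v = 1 then {p. p < a v \<and> f (v, p) \<in> {i, j}} else {})"
      proof -
        have yj: "y j $ v = 1 \<longleftrightarrow> y i $ v \<noteq> 1"
          using s y01[OF ij(1), of v] y01[OF ij(2), of v] by (auto simp: s_def)
        have gl: "g (v, p) = l \<longleftrightarrow> f (v, p) \<in> {i, j} \<and> y l $ v = 1" if "p < a v" for p
        proof (cases "f (v, p) \<in> {i, j}")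
          case f: True
          then have "g (v, p) = (if y i $ v = 1 then i else j)" using s by (simp only: g[OF that]) simp
          then show ?thesis using f True ij(3) yj by auto
        next
          case False
          then show ?thesis using True by (simp only: g[OF that]) auto
        qed
        have "{p. p < a v \<and> g (v, p) = l} = {p. p < a v \<and> f (v, p) \<in> {i, j} \<and> y l $ v = 1}"
          by (intro Collect_cong conj_cong refl gl)
        then show ?thesis by (cases "y l $ v = 1") simp_all
      qed
      ultimately show ?thesis
        using y01[OF l, of v] by (auto simp: class_vecs_nth[OF l])
    next
      case s: False
      then have "{p. p < a v \<and> g (v, p) = l} = {p. p < a v \<and> f (v, p) = l}"
        by (auto simp: g)
      then have "class_vecs g l $ v = class_vecs f l $ v" by (simp add: class_vecs_nth[OF l])
      \<comment> \<open>The sum of the two entries is 0 or 2 here, and two entries in {0, 1} are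
        determined by such a sum.\<close>
      moreover have "class_vecs f i $ v \<in> {0, 1}" "class_vecs f j $ v \<in> {0, 1}"
        using class_vecs_of_bool[OF f] ij by auto
      ultimately show ?thesis
        using True s s_sum[of v] y01[OF ij(1), of v] y01[OF ij(2), of v] by (auto simp: s_def)
    qed
  qed
  then have "class_vecs g = y"
    using class_vecs_tuple[OF gcol] y by (intro PiE_ext) (auto simp: vec_eq_iff)
  with gcol kempe show ?thesis by (rule that)
qed

text \<open>The copies of a vertex are adjacent twins, so exchanging the colors of two of them is a
  recoloring with two colors.\<close>

lemma same_class_vecs_kempe:
  assumes g: "g \<in> cols"
  shows "f \<in> cols \<Longrightarrow> class_vecs f = class_vecs g \<Longrightarrow> kempe f g"
proof (induction "card {x\<in>verts. f x \<noteq> g x}" arbitrary: f rule: less_induct)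
  case less
  note f = less.prems(1)
  show ?case
  proof (cases "\<exists>x\<in>verts. f x \<noteq> g x")
    case False
    then have "f = g"
      using coloringsD(1)[OF f] coloringsD(1)[OF g] by (intro PiE_ext) auto
    then show ?thesis by (simp add: kempe_equivalent_def)
  next
    case True
    then obtain v p where vp: "p < a v" "f (v, p) \<noteq> g (v, p)" by auto
    define i where "i = f (v, p)"
    define j where "j = g (v, p)"
    have ij: "i \<in> {1..k}" "j \<in> {1..k}" "i \<noteq> j"
      using cols_range[OF f vp(1)] cols_range[OF g vp(1)] vp(2) by (auto simp: i_def j_def)
    have "class_vecs f j $ v = class_vecs g j $ v" using less.prems(2) by simp
    \<comment> \<open>The color wanted at copy \<open>p\<close> occurs on some copy of
      \<open>v\<close> under \<open>g\<close>, hence also under \<open>f\<close>; that copy is the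
      partner of the exchange.\<close>
    then have "(\<exists>q<a v. f (v, q) = j) \<longleftrightarrow> (\<exists>q<a v. g (v, q) = j)"
      by (simp only: class_vecs_of_bool[OF f ij(2)] class_vecs_of_bool[OF g ij(2)] of_bool_eq_iff)
    then obtain q where q: "q < a v" "f (v, q) = j"
      using vp(1) j_def by blast
    have pq: "p \<noteq> q" using q ij by (auto simp: i_def)
    define t where "t = Transposition.transpose p q"
    define h where "h = (\<lambda>x\<in>verts. if fst x = v then f (v, t (snd x)) else f x)"
    have t: "t r < a v \<longleftrightarrow> r < a v" for r
      using vp(1) q(1) by (auto simp: t_def Transposition.transpose_def)
    have t_inj: "t r = t s \<longleftrightarrow> r = s" for r s
      by (simp add: t_def inj_eq[OF inj_transpose])
    have h: "h (u, r) = f (u, if u = v then t r else r)" if "r < a u" for u r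
      using that by (simp add: h_def)
    have "h (w, r) \<noteq> h (u, s)"
      if "r < a w" "s < a u" "w = u \<and> r \<noteq> s \<or> {w, u} \<in> E" for w r u s
      unfolding h[OF that(1)] h[OF that(2)]
      by (rule cols_proper[OF f]) (use that t t_inj in auto)
    moreover have "h \<in> verts \<rightarrow>\<^sub>E {1..k}"
    proof (rule PiE_I)
      fix x assume x: "x \<in> verts"
      obtain u r where ur: "x = (u, r)" "r < a u" using x by (cases x) auto
      show "h x \<in> {1..k}" unfolding ur(1) h[OF ur(2)]
        by (rule cols_range[OF f]) (use ur t in auto)
    qed (simp add: h_def)
    ultimately have hcol: "h \<in> cols" unfolding cols_iff by blast
    have h_cases: "h (u, r) = (if u = v \<and> r = p then j else if u = v \<and> r = q then i else f (u, r))"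
      if "r < a u" for u r
      using that pq q(2) by (auto simp: h i_def t_def)
    have rec: "recolors verts i j f h"
      unfolding recolors_def
    proof
      fix x assume "x \<in> verts"
      then obtain u r where "x = (u, r)" "r < a u" by (cases x) auto
      then show "if f x \<in> {i, j} then h x \<in> {i, j} else h x = f x"
        using q(2) by (auto simp: h_cases i_def)
    qed
    have "kempe f h"
      by (rule recolors_kempe_equivalent'[OF finite_verts ij f hcol rec])
    moreover have "kempe h g"
    proof (rule less.hyps[OF _ hcol])
      have "class_vecs h l $ u = class_vecs f l $ u" if l: "l \<in> {1..k}" for l u
      proof -
        have "(\<exists>r<a u. h (u, r) = l) \<longleftrightarrow> (\<exists>r<a u. f (u, r) = l)"
        proof (cases "u = v")
          case True
          have ht: "f (v, r) = h (v, t r)" "h (v, r) = f (v, t r)" if "r < a v" for r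
            using that t h[of r v] h[of "t r" v] by (simp_all add: t_def)
          show ?thesis unfolding True
          proof
            assume "\<exists>r<a v. h (v, r) = l"
            then obtain r where "r < a v" "h (v, r) = l" by blast
            then show "\<exists>r<a v. f (v, r) = l" using t ht(2) by (intro exI[of _ "t r"]) simp
          next
            assume "\<exists>r<a v. f (v, r) = l"
            then obtain r where "r < a v" "f (v, r) = l" by blast
            then show "\<exists>r<a v. h (v, r) = l" using t ht(1) by (intro exI[of _ "t r"]) simp
          qed
        qed (simp add: h cong: conj_cong)
        then show ?thesis
          by (simp only: class_vecs_of_bool[OF f l] class_vecs_of_bool[OF hcol l])
      qed
      then have "class_vecs h = class_vecs f"
        using class_vecs_tuple[OF f] class_vecs_tuple[OF hcol]
        by (intro PiE_ext) (auto simp: vec_eq_iff)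
      then show "class_vecs h = class_vecs g" using less.prems(2) by simp
      \<comment> \<open>The exchange spoils nothing at \<open>q\<close>: as \<open>g\<close> already
        uses \<open>j\<close> at \<open>p\<close>, the old color \<open>j\<close> of
        \<open>f\<close> at \<open>q\<close> was wrong.\<close>
      have gq: "g (v, q) \<noteq> j" using cols_proper[OF g vp(1) q(1)] pq by (auto simp: j_def)
      have "f x \<noteq> g x" if "x \<in> verts" "h x \<noteq> g x" for x
        using that gq q(2) vp(2) by (cases x) (auto simp: h_cases j_def split: if_splits)
      moreover have "h (v, p) = g (v, p)" using h_cases[OF vp(1)] by (simp add: j_def)
      ultimately have "{x\<in>verts. h x \<noteq> g x} \<subset> {x\<in>verts. f x \<noteq> g x}"
        using vp in_verts by blast
      then show "card {x\<in>verts. h x \<noteq> g x} < card {x\<in>verts. f x \<noteq> g x}"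
        using finite_verts by (intro psubset_card_mono) auto
    qed
    ultimately show ?thesis by (rule kempe_equivalent_trans)
  qed
qed

text \<open>Lifting the path move by move ends at a coloring with the color classes of
  \<open>g\<close> up to the naming of copies, and \<open>same_class_vecs_kempe\<close> corrects the
  copies.\<close>

lemma kempe_if_connected:
  assumes "(class_vecs f, class_vecs g) \<in> (tuple_moves (stable_vecs E) k)\<^sup>*"
    and f: "f \<in> cols" and g: "g \<in> cols"
  shows "kempe f g"
proof -
  have "\<exists>h\<in>cols. kempe f h \<and> class_vecs h = y"
    if "(class_vecs f, y) \<in> (tuple_moves (stable_vecs E) k)\<^sup>*" for y
    using that
  proof (induction rule: rtrancl_induct)
    case base
    show ?case using f by (auto simp: kempe_equivalent_def)
  next
    case (step y z)
    then obtain h where h: "h \<in> cols" "kempe f h" "class_vecs h = y" by blast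
    with step.hyps(2) obtain h' where "h' \<in> cols" "kempe h h'" "class_vecs h' = z"
      using lift_move[OF h(1)] by metis
    then show ?case using h kempe_equivalent_trans by blast
  qed
  from this[OF assms(1)] obtain h where "h \<in> cols" "kempe f h" "class_vecs h = class_vecs g" by blast
  then show ?thesis using same_class_vecs_kempe[OF g] kempe_equivalent_trans by blast
qed

end

lemma quad_connected_iff_kempe:
  fixes E :: "'n::finite set set"
  assumes E: "simple_graph UNIV E"
  shows "quad_connected (stable_vecs E) \<longleftrightarrow>
    (\<forall>a k. \<forall>f \<in> colorings (blowup_verts UNIV a) (blowup_edges UNIV E a) k.
           \<forall>g \<in> colorings (blowup_verts UNIV a) (blowup_edges UNIV E a) k.
             kempe_equivalent (blowup_verts UNIV a) (blowup_edges UNIV E a) k f g)"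
    (is "?conn \<longleftrightarrow> ?kempe")
proof
  assume conn: ?conn
  show ?kempe
  proof (intro allI ballI)
    fix a k f g
    interpret blowup E a k by standard (rule E)
    assume f: "f \<in> cols" and g: "g \<in> cols"
    have "sum (class_vecs f) {1..k} = sum (class_vecs g) {1..k}"
      using class_vecs_sum[OF f] class_vecs_sum[OF g] by (simp add: vec_eq_iff sum_component)
    then have "(class_vecs f, class_vecs g) \<in> (tuple_moves (stable_vecs E) k)\<^sup>*"
      using conn class_vecs_tuple[OF f] class_vecs_tuple[OF g] unfolding quad_connected_def by blast
    then show "kempe f g" using f g by (rule kempe_if_connected)
  qed
next
  assume kempe: ?kempe
  show ?conn
    unfolding quad_connected_def
  proof (intro allI ballI impI)
    fix k :: nat and x y :: "nat \<Rightarrow> int ^ 'n"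
    assume x: "x \<in> {1..k} \<rightarrow>\<^sub>E stable_vecs E" and y: "y \<in> {1..k} \<rightarrow>\<^sub>E stable_vecs E"
      and sum: "sum x {1..k} = sum y {1..k}"
    \<comment> \<open>The multiplicities are forced by the common sum of the two tuples; its
      coordinates are nonnegative, so \<open>nat\<close> loses nothing.\<close>
    define a where "a v = nat (\<Sum>i\<in>{1..k}. x i $ v)" for v
    interpret blowup E a k by standard (rule E)
    have nonneg: "0 \<le> x i $ v" if "i \<in> {1..k}" for i v
    proof -
      have "x i \<in> stable_vecs E" using x that by blast
      then have "x i $ v \<in> {0, 1}" unfolding stable_vecs_def by blast
      then show ?thesis by auto
    qed
    have ax: "(\<Sum>i\<in>{1..k}. x i $ v) = int (a v)" for v
    proof -
      have "0 \<le> (\<Sum>i\<in>{1..k}. x i $ v)" by (rule sum_nonneg) (rule nonneg)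
      then show ?thesis by (simp add: a_def)
    qed
    moreover have "(\<Sum>i\<in>{1..k}. y i $ v) = (\<Sum>i\<in>{1..k}. x i $ v)" for v
      using sum by (metis sum_component)
    ultimately have ay: "(\<Sum>i\<in>{1..k}. y i $ v) = int (a v)" for v by simp
    obtain f where f: "f \<in> cols" "class_vecs f = x" using ex_coloring[OF x ax] .
    obtain g where g: "g \<in> cols" "class_vecs g = y" using ex_coloring[OF y ay] .
    show "(x, y) \<in> (tuple_moves (stable_vecs E) k)\<^sup>*"
      using kempe_moves[of f g] kempe f g by blast
  qed
qed

text \<open>A coloring with \<open>k\<close> colors itself witnesses the bound on \<open>k\<close>
  in (iii), which matches that condition with the quantification over all \<open>k\<close> in
  \<open>quad_connected_iff_kempe\<close>.\<close>

lemma chromatic_number_le: "f \<in> colorings V E k \<Longrightarrow> chromatic_number V E \<le> k"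
  unfolding chromatic_number_def by (rule Least_le) blast

theorem theorem3p12:
  fixes E :: "'n::finite set set"
  assumes "simple_graph (UNIV :: 'n set) E"
  shows "(generated_by_quadratic_binomials (lattice_points (sym_stable_set_polytope E))
            (sym_stable_set_ideal TYPE('k::field) E)
          \<longleftrightarrow>
          generated_by_quadratic_binomials (lattice_points (stable_set_polytope E))
            (stable_set_ideal TYPE('k) E))
       \<and> (generated_by_quadratic_binomials (lattice_points (stable_set_polytope E))
            (stable_set_ideal TYPE('k) E)
          \<longleftrightarrow>
          (\<forall>(a :: 'n \<Rightarrow> nat) k.
             k \<ge> chromatic_number (blowup_verts UNIV a) (blowup_edges UNIV E a) \<longrightarrow>
             (\<forall>f \<in> colorings (blowup_verts UNIV a) (blowup_edges UNIV E a) k.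
              \<forall>g \<in> colorings (blowup_verts UNIV a) (blowup_edges UNIV E a) k.
                kempe_equivalent (blowup_verts UNIV a) (blowup_edges UNIV E a) k f g)))"
proof -
  have "generated_by_quadratic_binomials (lattice_points (sym_stable_set_polytope E))
      (sym_stable_set_ideal TYPE('k) E) \<longleftrightarrow> quad_connected (signed_stable_vecs E)"
    unfolding sym_stable_set_ideal_def generated_iff_quad_connected
    unfolding lattice_points_sym_stable_set_polytope[OF assms] ..
  moreover have "generated_by_quadratic_binomials (lattice_points (stable_set_polytope E))
      (stable_set_ideal TYPE('k) E) \<longleftrightarrow> quad_connected (stable_vecs E)"
    unfolding stable_set_ideal_def generated_iff_quad_connected
    unfolding lattice_points_stable_set_polytope[OF assms] ..
  moreover have "quad_connected (signed_stable_vecs E) \<longleftrightarrow> quad_connected (stable_vecs E)"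
    using quad_connected_stable_if_signed quad_connected_signed_if_stable by blast
  ultimately show ?thesis
    using quad_connected_iff_kempe[OF assms] chromatic_number_le by (simp only:) blast
qed

end
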